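(* Let $a\in\mathbb{Z}$ and $p\ge1$, and suppose that either $a\ge1$ and $p=1$, or $a\ge2$ and $p>1$. Let $T:\ell^p(\mathbb{Z},\omega_a)\to\ell^p(\mathbb{Z},\omega_a)$ be an algebra isomorphism. Then $T$ can be extended to a continuous operator on $\ell^p(\mathbb{Z})$, and this extension is a linear isomorphism of $\ell^p(\mathbb{Z})$.
   Context: For $a\ge0$, $\omega_a(n)=\max(1,|n|^a)$, $n\in\mathbb{Z}$. $\ell^p(\mathbb{Z},\omega_a)$ is the space of sequences $f=(f_n)_{n\in\mathbb{Z}}$ with $\sum_n|f_n|^p\omega_a(n)^p<\infty$, normed by $\left(\sum_n|f_n|^p\omega_a(n)^p\right)^{1/p}$; under the given hypotheses it is an algebra under convolution, and $\ell^p(\mathbb{Z},\omega_a)\subset\ell^p(\mathbb{Z})$. *)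

theory Defs
  imports "HOL-Analysis.Analysis"
begin

definition weight :: "int \<Rightarrow> int \<Rightarrow> real" where
  "weight a n = max 1 (real_of_int \<bar>n\<bar> ^ nat a)"

definition lp_weighted :: "real \<Rightarrow> int \<Rightarrow> (int \<Rightarrow> complex) set" where
  "lp_weighted p a = {f. (\<lambda>n. (norm (f n) * weight a n) powr p) summable_on UNIV}"

definition lp_space :: "real \<Rightarrow> (int \<Rightarrow> complex) set" where
  "lp_space p = {f. (\<lambda>n. norm (f n) powr p) summable_on UNIV}"

definition lp_norm :: "real \<Rightarrow> (int \<Rightarrow> complex) \<Rightarrow> real" where
  "lp_norm p f = (\<Sum>\<^sub>\<infinity>n. norm (f n) powr p) powr (1 / p)"

definition conv :: "(int \<Rightarrow> complex) \<Rightarrow> (int \<Rightarrow> complex) \<Rightarrow> int \<Rightarrow> complex" where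
  "conv f g n = (\<Sum>\<^sub>\<infinity>k. f k * g (n - k))"

definition linear_on_seq :: "(int \<Rightarrow> complex) set \<Rightarrow> ((int \<Rightarrow> complex) \<Rightarrow> (int \<Rightarrow> complex)) \<Rightarrow> bool" where
  "linear_on_seq A T \<longleftrightarrow>
     (\<forall>f\<in>A. \<forall>g\<in>A. T (\<lambda>n. f n + g n) = (\<lambda>n. T f n + T g n)) \<and>
     (\<forall>c. \<forall>f\<in>A. T (\<lambda>n. c * f n) = (\<lambda>n. c * T f n))"

definition algebra_iso_on :: "(int \<Rightarrow> complex) set \<Rightarrow> ((int \<Rightarrow> complex) \<Rightarrow> (int \<Rightarrow> complex)) \<Rightarrow> bool" where
  "algebra_iso_on A T \<longleftrightarrow>
     bij_betw T A A \<and> linear_on_seq A T \<and>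
     (\<forall>f\<in>A. \<forall>g\<in>A. T (conv f g) = conv (T f) (T g))"

end

theory Submission
  imports Defs
begin

text \<open>
  Write \<open>A\<close> for the weighted space and \<open>F f\<close> for the Fourier series of \<open>f\<close>. Polynomial weights leave
  the spectral radius in \<open>A\<close> equal to the sup norm on the unit circle; a Neumann series for
  \<open>1 - |v|\<^sup>2 / R\<close> then gives Wiener's lemma, and Wiener's lemma identifies the characters of \<open>A\<close> with
  the points of the circle. Hence \<open>T\<close> is composition with a map \<open>\<phi> = F (T \<delta>\<^sub>1)\<close> of the circle to
  itself, and it is continuous by Baire's theorem. Both \<open>\<phi>\<close> and its inverse are continuously
  differentiable, so \<open>\<phi>'\<close> has no zero and \<open>1 / \<phi>'\<close> lies in the space with weight exponent \<open>a - 1\<close>.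
  With \<open>D\<close> the derivation \<open>f\<^sub>n \<mapsto> n f\<^sub>n\<close>, the chain rule reads \<open>T (D g) = w * D (T g)\<close> for a fixed \<open>w\<close> in
  that space. Each application trades one power of the weight for one derivative, so \<open>a\<close>
  applications turn boundedness of \<open>T\<close> on \<open>A\<close> into boundedness on unweighted \<open>l\<^sup>p\<close>. The same
  applies to the inverse of \<open>T\<close>.
\<close>

section \<open>Bounds for l^p norms\<close>

text \<open>The obstacle is that \<open>T\<close> is controlled only in the weighted norm, which
  dominates the norm of l^p. For a finitely supported \<open>f\<close>, dividing the coefficients at
  n \<noteq> 0 by n^a and dropping the one at 0 produces a \<open>g\<close> whose weighted norm is
  at most the l^p norm of \<open>f\<close>, and D applied a times to \<open>g\<close> restores
  \<open>f\<close> up to its coefficient at 0. The chain rule moves these a derivatives past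
  \<open>T\<close> one at a time, each costing one power of the weight in the target. The
  restriction on the exponents comes from 1 / \<phi>': Wiener's lemma is applied at exponent a - 1,
  in a space that has to lie in l^1. This holds for p = 1, and for p > 1 it follows from Hoelder's
  inequality once a - 1 \<ge> 1. Finitely supported sequences are mapped to such sequences by D, and
  they are dense in l^p, so the unweighted bound on them determines the extension.\<close>

text \<open>Bounding all finite partial sums makes the bound stable under pointwise limits, so estimates for
  infinite sums of sequences reduce to the finite triangle inequality.\<close>

definition lp_bounded :: "real \<Rightarrow> (int \<Rightarrow> complex) \<Rightarrow> real \<Rightarrow> bool" where
  "lp_bounded p f M \<longleftrightarrow> M \<ge> 0 \<and> (\<forall>F. finite F \<longrightarrow> (\<Sum>n\<in>F. norm (f n) powr p) \<le> M powr p)"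

lemma lp_bounded_nonneg: "lp_bounded p f M \<Longrightarrow> M \<ge> 0"
  by (simp add: lp_bounded_def)

lemma lp_bounded_coord:
  assumes "p \<ge> 1" "lp_bounded p f M"
  shows "norm (f n) \<le> M"
proof (rule ccontr)
  assume "\<not> norm (f n) \<le> M"
  then have "M powr p < norm (f n) powr p"
    using assms by (intro powr_less_mono2) (auto simp: lp_bounded_def)
  moreover have "(\<Sum>m\<in>{n}. norm (f m) powr p) \<le> M powr p"
    using assms(2)[unfolded lp_bounded_def, THEN conjunct2, THEN spec, of "{n}"] by simp
  ultimately show False by simp
qed

lemma lp_bounded_mono:
  assumes "p \<ge> 1" "lp_bounded p g M" "\<And>n. norm (f n) \<le> norm (g n)" "M \<le> N"
  shows "lp_bounded p f N"
  unfolding lp_bounded_def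
proof (intro conjI allI impI)
  show "0 \<le> N" using lp_bounded_nonneg assms by force
  fix F :: "int set" assume F: "finite F"
  have "(\<Sum>n\<in>F. norm (f n) powr p) \<le> (\<Sum>n\<in>F. norm (g n) powr p)"
    using assms by (intro sum_mono powr_mono2) auto
  also have "\<dots> \<le> M powr p" using assms F by (auto simp: lp_bounded_def)
  also have "\<dots> \<le> N powr p" using assms by (intro powr_mono2) (auto simp: lp_bounded_def)
  finally show "(\<Sum>n\<in>F. norm (f n) powr p) \<le> N powr p" .
qed

lemma lp_bounded_scale:
  assumes "p \<ge> 1" "lp_bounded p f M"
  shows "lp_bounded p (\<lambda>n. c * f n) (norm c * M)"
  unfolding lp_bounded_def
proof (intro conjI allI impI)
  show "0 \<le> norm c * M" using assms by (auto simp: lp_bounded_def)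
  fix F :: "int set" assume F: "finite F"
  have "(\<Sum>n\<in>F. norm (c * f n) powr p) = norm c powr p * (\<Sum>n\<in>F. norm (f n) powr p)"
    by (simp add: norm_mult powr_mult sum_distrib_left)
  also have "\<dots> \<le> norm c powr p * M powr p"
    using assms F by (intro mult_left_mono) (auto simp: lp_bounded_def)
  finally show "(\<Sum>n\<in>F. norm (c * f n) powr p) \<le> (norm c * M) powr p"
    using assms by (simp add: powr_mult lp_bounded_def)
qed

lemma lp_bounded_zero: "lp_bounded p (\<lambda>n. 0) 0"
  by (simp add: lp_bounded_def)

text \<open>When one of the two points is 0, convexity of the power reduces to
  \<open>s powr p \<le> s\<close> for s in [0, 1]; this case is split off from the convexity on
  positive numbers.\<close>

lemma powr_convex_nonneg:
  fixes x y t p :: real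
  assumes "p \<ge> 1" "x \<ge> 0" "y \<ge> 0" "0 \<le> t" "t \<le> 1"
  shows "((1 - t) * x + t * y) powr p \<le> (1 - t) * x powr p + t * y powr p"
proof -
  have le: "s powr p \<le> s" if "0 \<le> s" "s \<le> 1" for s :: real
    using powr_mono'[of 1 p s] that assms by simp
  have "(s * z) powr p \<le> s * z powr p" if "0 \<le> s" "s \<le> 1" "z \<ge> 0" for s z :: real
    using that le[of s] by (simp add: powr_mult mult_right_mono)
  then have "x = 0 \<or> y = 0 \<Longrightarrow> ?thesis"
    using assms by auto
  moreover have "?thesis" if "x > 0" "y > 0"
    using convex_onD[OF powr_convex[OF assms(1)], of t x y] that assms by simp
  ultimately show ?thesis using assms by fastforce
qed

text \<open>Minkowski's inequality through convexity: |f + g| / (M + N) is at most the convex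
  combination of |f| / M and |g| / N with weights M / (M + N) and N / (M + N). As this divides by
  the bounds, a vanishing bound is treated apart; it forces its sequence to be 0.\<close>

lemma lp_bounded_add:
  assumes p: "p \<ge> 1" and f: "lp_bounded p f M" and g: "lp_bounded p g N"
  shows "lp_bounded p (\<lambda>n. f n + g n) (M + N)"
proof (cases "M > 0 \<and> N > 0")
  case False
  then consider "M = 0" | "N = 0" using f g by (force simp: lp_bounded_def)
  then show ?thesis
  proof cases
    case 1
    then have "f n = 0" for n using lp_bounded_coord[OF p f, of n] by simp
    then show ?thesis using 1 g by simp
  next
    case 2
    then have "g n = 0" for n using lp_bounded_coord[OF p g, of n] by simp
    then show ?thesis using 2 f by simp
  qed
next
  case True
  define s where "s = M + N"
  define t where "t = N / s"
  have s: "s > 0" and t: "0 \<le> t" "t \<le> 1" and sM: "s * (1 - t) = M" and sN: "s * t = N"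
    using True by (auto simp: s_def t_def field_simps)
  show ?thesis
    unfolding lp_bounded_def
  proof (intro conjI allI impI)
    show "0 \<le> M + N" using True by simp
    fix F :: "int set" assume F: "finite F"
    have *: "norm (f n + g n) powr p \<le> s powr p * ((1 - t) * (norm (f n) powr p / M powr p) + t * (norm (g n) powr p / N powr p))" for n
    proof -
      have "norm (f n + g n) \<le> s * ((1 - t) * (norm (f n) / M) + t * (norm (g n) / N))"
        using norm_triangle_ineq[of "f n" "g n"] True
        by (simp add: distrib_left mult.assoc[symmetric] sM sN)
      then have "norm (f n + g n) powr p \<le> (s * ((1 - t) * (norm (f n) / M) + t * (norm (g n) / N))) powr p"
        using p by (intro powr_mono2) auto
      also have "\<dots> = s powr p * ((1 - t) * (norm (f n) / M) + t * (norm (g n) / N)) powr p"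
        using s t True by (intro powr_mult)
      also have "\<dots> \<le> s powr p * ((1 - t) * (norm (f n) / M) powr p + t * (norm (g n) / N) powr p)"
        using True t p by (intro mult_left_mono powr_convex_nonneg) auto
      finally show ?thesis using True by (simp add: powr_divide)
    qed
    have "(\<Sum>n\<in>F. norm (f n + g n) powr p) \<le>
       (\<Sum>n\<in>F. s powr p * ((1 - t) * (norm (f n) powr p / M powr p) + t * (norm (g n) powr p / N powr p)))"
      by (intro sum_mono *)
    also have "\<dots> = s powr p * ((1 - t) * ((\<Sum>n\<in>F. norm (f n) powr p) / M powr p) + t * ((\<Sum>n\<in>F. norm (g n) powr p) / N powr p))"
      by (simp add: sum_distrib_left[symmetric] sum.distrib sum_divide_distrib[symmetric])
    also have "\<dots> \<le> s powr p * ((1 - t) * 1 + t * 1)"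
      using f g F True t by (intro mult_left_mono add_mono) (auto simp: lp_bounded_def divide_le_eq_1)
    finally show "(\<Sum>n\<in>F. norm (f n + g n) powr p) \<le> (M + N) powr p" by (simp add: s_def)
  qed
qed

lemma lp_bounded_diff:
  assumes "p \<ge> 1" "lp_bounded p f M" "lp_bounded p g N"
  shows "lp_bounded p (\<lambda>n. f n - g n) (M + N)"
  using lp_bounded_add[OF assms(1,2) lp_bounded_scale[OF assms(1,3), of "-1"]] by simp

lemma lp_bounded_sum:
  assumes "p \<ge> 1" "\<And>i. i \<in> I \<Longrightarrow> lp_bounded p (f i) (M i)"
  shows "lp_bounded p (\<lambda>n. \<Sum>i\<in>I. f i n) (\<Sum>i\<in>I. M i)"
  using assms(2)
proof (induction I rule: infinite_finite_induct)
  case (insert i I)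
  then show ?case using lp_bounded_add[OF assms(1)] by simp
qed (auto simp: lp_bounded_zero)

text \<open>A Fatou property: a finite partial sum sees only finitely many coordinates, so pointwise
  convergence is enough. The filter is arbitrary because limits are taken both along sequences and
  along finite index sets.\<close>

lemma lp_bounded_tendsto:
  assumes p: "p \<ge> 1" and F: "F \<noteq> bot" and lim: "\<And>n. ((\<lambda>i. f i n) \<longlongrightarrow> g n) F"
    and bnd: "eventually (\<lambda>i. lp_bounded p (f i) M) F"
  shows "lp_bounded p g M"
  unfolding lp_bounded_def
proof (intro conjI allI impI)
  show "0 \<le> M" using eventually_happens'[OF F bnd] lp_bounded_nonneg by blast
  fix X :: "int set" assume X: "finite X"
  have "((\<lambda>i. \<Sum>n\<in>X. norm (f i n) powr p) \<longlongrightarrow> (\<Sum>n\<in>X. norm (g n) powr p)) F"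
    using p by (intro tendsto_sum tendsto_powr' tendsto_norm lim tendsto_const) auto
  then show "(\<Sum>n\<in>X. norm (g n) powr p) \<le> M powr p"
  proof (rule tendsto_upperbound)
    show "\<forall>\<^sub>F i in F. (\<Sum>n\<in>X. norm (f i n) powr p) \<le> M powr p"
      using bnd by eventually_elim (use X in \<open>auto simp: lp_bounded_def\<close>)
  qed (fact F)
qed

lemma lp_bounded_suminf:
  assumes p: "p \<ge> 1" and f: "\<And>i::nat. lp_bounded p (f i) (M i)" and M: "summable M"
  shows "summable (\<lambda>i. f i n)" "lp_bounded p (\<lambda>n. \<Sum>i. f i n) (suminf M)"
proof -
  have sm: "summable (\<lambda>i. f i n)" for n
    by (rule summable_comparison_test'[OF M, of 0]) (rule lp_bounded_coord[OF p f])
  then show "summable (\<lambda>i. f i n)" .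
  have "lp_bounded p (\<lambda>n. \<Sum>i<N. f i n) (suminf M)" for N
    by (rule lp_bounded_mono[OF p lp_bounded_sum[OF p f, where I = "{..<N}"]])
       (auto intro!: sum_le_suminf M lp_bounded_nonneg[OF f])
  then have evt: "\<forall>\<^sub>F N in sequentially. lp_bounded p (\<lambda>n. \<Sum>i<N. f i n) (suminf M)"
    by (rule always_eventually[OF allI])
  show "lp_bounded p (\<lambda>n. \<Sum>i. f i n) (suminf M)"
  proof (rule lp_bounded_tendsto[OF p sequentially_bot _ evt])
    show "(\<lambda>N. \<Sum>i<N. f i n) \<longlonglongrightarrow> (\<Sum>i. f i n)" for n
      by (rule summable_LIMSEQ[OF sm])
  qed
qed

lemma lp_bounded_shift:
  assumes "lp_bounded p f M"
  shows "lp_bounded p (\<lambda>n. f (n - k)) M"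
  unfolding lp_bounded_def
proof (intro conjI allI impI)
  show "0 \<le> M" using assms by (simp add: lp_bounded_def)
  fix F :: "int set" assume F: "finite F"
  have "(\<Sum>n\<in>F. norm (f (n - k)) powr p) = (\<Sum>n\<in>(\<lambda>n. n - k) ` F. norm (f n) powr p)"
    by (subst sum.reindex) (auto simp: inj_on_def)
  then show "(\<Sum>n\<in>F. norm (f (n - k)) powr p) \<le> M powr p"
    using assms F by (auto simp: lp_bounded_def)
qed

section \<open>Unit sequences, truncation and convolution\<close>

definition delta :: "int \<Rightarrow> int \<Rightarrow> complex" where
  "delta k n = (if n = k then 1 else 0)"

definition trunc :: "int set \<Rightarrow> (int \<Rightarrow> complex) \<Rightarrow> int \<Rightarrow> complex" where
  "trunc F f n = (if n \<in> F then f n else 0)"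

lemma trunc_eq_sum: "finite F \<Longrightarrow> trunc F f = (\<lambda>n. \<Sum>k\<in>F. f k * delta k n)"
  by (auto simp: trunc_def delta_def if_distrib if_distribR sum.delta cong: if_cong)

lemma trunc_tendsto: "((\<lambda>F. trunc F f n) \<longlongrightarrow> f n) (finite_subsets_at_top UNIV)"
proof (rule tendsto_eventually)
  show "\<forall>\<^sub>F F in finite_subsets_at_top UNIV. trunc F f n = f n"
    unfolding eventually_finite_subsets_at_top by (rule exI[of _ "{n}"]) (simp add: trunc_def)
qed

lemma lp_bounded_delta: "lp_bounded p (delta k) 1"
  unfolding lp_bounded_def
proof (intro conjI allI impI)
  fix F :: "int set" assume F: "finite F"
  have "norm (delta k n) powr p = (if k = n then 1 else 0)" for n
    by (simp add: delta_def)
  then have "(\<Sum>n\<in>F. norm (delta k n) powr p) = (\<Sum>n\<in>F. if k = n then 1 else 0)"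
    by (simp only:)
  then show "(\<Sum>n\<in>F. norm (delta k n) powr p) \<le> 1 powr p"
    using F by simp
qed simp

lemma lp_bounded_1_iff: "lp_bounded 1 f M \<longleftrightarrow> M \<ge> 0 \<and> (\<forall>F. finite F \<longrightarrow> (\<Sum>n\<in>F. norm (f n)) \<le> M)"
  by (simp add: lp_bounded_def cong: conj_cong)

lemma lp_bounded_1_D: "lp_bounded 1 f M \<Longrightarrow> (\<lambda>n. norm (f n)) summable_on UNIV"
  by (auto simp: lp_bounded_1_iff abs_summable_iff_bdd_above bdd_above_def)

lemma abs_summable_lp_bounded_1:
  "(\<lambda>n. norm (f n)) summable_on UNIV \<Longrightarrow> lp_bounded 1 f (\<Sum>\<^sub>\<infinity>n. norm (f n))"
  unfolding lp_bounded_1_iff by (auto intro: infsum_nonneg finite_sum_le_infsum)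

lemma lp_bounded_1_infsum_le: "lp_bounded 1 f M \<Longrightarrow> (\<Sum>\<^sub>\<infinity>n. norm (f n)) \<le> M"
  by (intro infsum_le_finite_sums lp_bounded_1_D) (auto simp: lp_bounded_1_iff)

text \<open>A truncation is a finite combination of sequences \<open>delta k\<close>, each of l^p
  bound 1, so the triangle inequality bounds it by its l^1 norm; pointwise limits keep the
  bound.\<close>

lemma lp_bounded_1_imp:
  assumes "p \<ge> 1" "lp_bounded 1 f M" shows "lp_bounded p f M"
proof (rule lp_bounded_tendsto[OF assms(1)])
  show "((\<lambda>F. trunc F f n) \<longlongrightarrow> f n) (finite_subsets_at_top UNIV)" for n
    by (rule trunc_tendsto)
  show "\<forall>\<^sub>F F in finite_subsets_at_top UNIV. lp_bounded p (trunc F f) M"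
  proof (rule eventually_finite_subsets_at_top_weakI)
    fix F :: "int set" assume F: "finite F"
    have "lp_bounded p (trunc F f) (\<Sum>k\<in>F. norm (f k) * 1)"
      unfolding trunc_eq_sum[OF F]
      by (intro lp_bounded_sum lp_bounded_scale lp_bounded_delta assms)
    then show "lp_bounded p (trunc F f) M"
      using assms F by (elim lp_bounded_mono[rotated]) (auto simp: lp_bounded_1_iff)
  qed
qed auto

lemma lp_bounded_conv_summable:
  assumes "p \<ge> 1" "lp_bounded p f M" "(\<lambda>n. norm (g n)) summable_on UNIV"
  shows "(\<lambda>k. norm (g k * f (n - k))) summable_on UNIV"
proof (rule Infinite_Sum.abs_summable_on_comparison_test)
  show "(\<lambda>k. norm (of_real M * g k)) summable_on UNIV"
    using assms(3) by (simp add: norm_mult summable_on_cmult_right)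
  show "norm (g k * f (n - k)) \<le> norm (of_real M * g k)" for k
    using lp_bounded_coord[OF assms(1,2), of "n - k"] lp_bounded_nonneg[OF assms(2)]
    by (simp add: norm_mult mult.commute[of M] mult_left_mono)
qed

lemma conv_commute: "conv f g = conv g f"
proof
  fix n
  show "conv f g n = conv g f n"
    unfolding conv_def
    by (rule infsum_reindex_bij_witness[of _ "\<lambda>k. n - k" "\<lambda>k. n - k"]) auto
qed

text \<open>Young's inequality: \<open>conv g f\<close> is a pointwise limit of finite sums of
  translates of \<open>f\<close> with coefficients \<open>g k\<close>, and translation preserves the
  bound of \<open>f\<close>.\<close>

lemma lp_bounded_conv:
  assumes p: "p \<ge> 1" and f: "lp_bounded p f M" and g: "lp_bounded 1 g L"
  shows "lp_bounded p (conv g f) (L * M)"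
proof (rule lp_bounded_tendsto[OF p])
  note gs = lp_bounded_1_D[OF g]
  show "((\<lambda>F. \<Sum>k\<in>F. g k * f (n - k)) \<longlongrightarrow> conv g f n) (finite_subsets_at_top UNIV)" for n
    unfolding conv_def
    by (rule infsum_tendsto[OF abs_summable_summable[OF lp_bounded_conv_summable[OF p f gs]]])
  show "\<forall>\<^sub>F F in finite_subsets_at_top UNIV. lp_bounded p (\<lambda>n. \<Sum>k\<in>F. g k * f (n - k)) (L * M)"
  proof (rule eventually_finite_subsets_at_top_weakI)
    fix F :: "int set" assume F: "finite F"
    have "lp_bounded p (\<lambda>n. \<Sum>k\<in>F. g k * f (n - k)) (\<Sum>k\<in>F. norm (g k) * M)"
      by (intro lp_bounded_sum lp_bounded_scale lp_bounded_shift p f)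
    then show "lp_bounded p (\<lambda>n. \<Sum>k\<in>F. g k * f (n - k)) (L * M)"
      using g F lp_bounded_nonneg[OF f]
      by (elim lp_bounded_mono[OF p])
         (auto simp: lp_bounded_1_iff sum_distrib_right[symmetric] mult_right_mono)
  qed
qed auto

lemma lp_bounded_trunc_small:
  assumes p: "p \<ge> 1" and f: "lp_bounded p f M" and e: "e > 0"
  shows "\<exists>F. finite F \<and> lp_bounded p (\<lambda>n. f n - trunc F f n) e"
proof -
  have s: "(\<lambda>n. norm (f n) powr p) summable_on UNIV"
    using f by (intro nonneg_bdd_above_summable_on) (auto simp: lp_bounded_def bdd_above_def)
  have "e powr p > 0" using e by simp
  from infsum_finite_approximation[OF s this] obtain F
    where F: "finite F" "dist (\<Sum>n\<in>F. norm (f n) powr p) (\<Sum>\<^sub>\<infinity>n. norm (f n) powr p) \<le> e powr p"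
    by auto
  have "lp_bounded p (\<lambda>n. f n - trunc F f n) e"
    unfolding lp_bounded_def
  proof (intro conjI allI impI)
    fix X :: "int set" assume X: "finite X"
    have "(\<Sum>n\<in>X. norm (f n - trunc F f n) powr p) = (\<Sum>n\<in>X - F. norm (f n) powr p)"
      using X by (intro sum.mono_neutral_cong_right) (auto simp: trunc_def)
    also have "\<dots> = (\<Sum>n\<in>(X - F) \<union> F. norm (f n) powr p) - (\<Sum>n\<in>F. norm (f n) powr p)"
      using X F by (subst sum.union_disjoint) auto
    also have "\<dots> \<le> (\<Sum>\<^sub>\<infinity>n. norm (f n) powr p) - (\<Sum>n\<in>F. norm (f n) powr p)"
      using X F s by (intro diff_right_mono finite_sum_le_infsum) auto
    also have "\<dots> \<le> e powr p" using F by (simp add: dist_real_def)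
    finally show "(\<Sum>n\<in>X. norm (f n - trunc F f n) powr p) \<le> e powr p" .
  qed (use e in simp)
  then show ?thesis using F by blast
qed

text \<open>Together these say that \<open>lp_norm p f\<close> is the least bound of
  \<open>f\<close>. Estimates are made with bounds; the norm itself returns for the metric in the
  Baire argument and in the final theorem.\<close>

lemma lp_space_iff_bounded: "p \<ge> 1 \<Longrightarrow> f \<in> lp_space p \<longleftrightarrow> (\<exists>M. lp_bounded p f M)"
  and lp_bounded_lp_norm: "p \<ge> 1 \<Longrightarrow> f \<in> lp_space p \<Longrightarrow> lp_bounded p f (lp_norm p f)"
  and lp_norm_le: "p \<ge> 1 \<Longrightarrow> lp_bounded p f M \<Longrightarrow> lp_norm p f \<le> M"
proof -
  assume p: "p \<ge> 1"
  show *: "lp_bounded p f (lp_norm p f)" if "f \<in> lp_space p"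
    unfolding lp_bounded_def
  proof (intro conjI allI impI)
    show "0 \<le> lp_norm p f" by (simp add: lp_norm_def)
    fix F :: "int set" assume "finite F"
    then have "(\<Sum>n\<in>F. norm (f n) powr p) \<le> (\<Sum>\<^sub>\<infinity>n. norm (f n) powr p)"
      using that by (intro finite_sum_le_infsum) (auto simp: lp_space_def)
    also have "\<dots> = lp_norm p f powr p"
      using p infsum_nonneg[of UNIV "\<lambda>n. norm (f n) powr p"] by (simp add: lp_norm_def powr_powr)
    finally show "(\<Sum>n\<in>F. norm (f n) powr p) \<le> lp_norm p f powr p" .
  qed
  have sm: "(\<lambda>n. norm (f n) powr p) summable_on UNIV" if "lp_bounded p f M" for M
    using that by (intro nonneg_bdd_above_summable_on) (auto simp: lp_bounded_def bdd_above_def)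
  show "f \<in> lp_space p \<longleftrightarrow> (\<exists>M. lp_bounded p f M)"
    using * sm by (auto simp: lp_space_def)
  show "lp_norm p f \<le> M" if "lp_bounded p f M"
  proof -
    have "(\<Sum>\<^sub>\<infinity>n. norm (f n) powr p) \<le> M powr p"
      using that by (intro infsum_le_finite_sums sm) (auto simp: lp_bounded_def)
    then have "lp_norm p f \<le> (M powr p) powr (1 / p)"
      unfolding lp_norm_def using p by (intro powr_mono2 infsum_nonneg) auto
    then show ?thesis using p lp_bounded_nonneg[OF that] by (simp add: powr_powr)
  qed
qed

section \<open>Fourier series of absolutely summable sequences\<close>

abbreviation l1 :: "(int \<Rightarrow> complex) \<Rightarrow> bool" where
  "l1 f \<equiv> (\<lambda>n. norm (f n)) summable_on UNIV"

definition fourier :: "(int \<Rightarrow> complex) \<Rightarrow> complex \<Rightarrow> complex" where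
  "fourier f z = (\<Sum>\<^sub>\<infinity>n. f n * z powi n)"

lemma l1_add: "l1 f \<Longrightarrow> l1 g \<Longrightarrow> l1 (\<lambda>n. f n + g n)"
  by (rule lp_bounded_1_D[OF lp_bounded_add]) (auto intro: abs_summable_lp_bounded_1)

lemma l1_diff: "l1 f \<Longrightarrow> l1 g \<Longrightarrow> l1 (\<lambda>n. f n - g n)"
  by (rule lp_bounded_1_D[OF lp_bounded_diff]) (auto intro: abs_summable_lp_bounded_1)

lemma l1_scale: "l1 f \<Longrightarrow> l1 (\<lambda>n. c * f n)"
  by (rule lp_bounded_1_D[OF lp_bounded_scale]) (auto intro: abs_summable_lp_bounded_1)

lemma l1_delta: "l1 (delta k)"
  by (rule lp_bounded_1_D[OF lp_bounded_delta])

lemma l1_conv: "l1 f \<Longrightarrow> l1 g \<Longrightarrow> l1 (conv f g)"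
  by (rule lp_bounded_1_D[OF lp_bounded_conv]) (auto intro: abs_summable_lp_bounded_1)

lemma l1_trunc: "l1 f \<Longrightarrow> l1 (trunc F f)"
  by (rule lp_bounded_1_D[OF lp_bounded_mono]) (auto simp: trunc_def intro: abs_summable_lp_bounded_1)

lemma norm_powi_unit: "norm (z::complex) = 1 \<Longrightarrow> norm (z powi n) = 1"
  by (simp add: norm_power_int)

lemma fourier_abs_summable: "l1 f \<Longrightarrow> norm z = 1 \<Longrightarrow> (\<lambda>n. norm (f n * z powi n)) summable_on UNIV"
  by (simp add: norm_mult norm_powi_unit)

lemma fourier_summable: "l1 f \<Longrightarrow> norm z = 1 \<Longrightarrow> (\<lambda>n. f n * z powi n) summable_on UNIV"
  by (rule abs_summable_summable[OF fourier_abs_summable])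

lemma fourier_add: "l1 f \<Longrightarrow> l1 g \<Longrightarrow> norm z = 1 \<Longrightarrow> fourier (\<lambda>n. f n + g n) z = fourier f z + fourier g z"
  by (simp add: fourier_def distrib_right infsum_add fourier_summable)

lemma fourier_scale: "fourier (\<lambda>n. c * f n) z = c * fourier f z"
  by (simp add: fourier_def mult.assoc infsum_cmult_right')

lemma fourier_diff: "l1 f \<Longrightarrow> l1 g \<Longrightarrow> norm z = 1 \<Longrightarrow> fourier (\<lambda>n. f n - g n) z = fourier f z - fourier g z"
  using fourier_add[of f "\<lambda>n. -1 * g n" z] l1_scale[of g "-1"] fourier_scale[of "-1" g z] by simp

lemma fourier_finite_support:
  assumes "finite F" "\<And>n. n \<notin> F \<Longrightarrow> f n = 0"
  shows "fourier f z = (\<Sum>n\<in>F. f n * z powi n)"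
proof -
  have "(\<Sum>\<^sub>\<infinity>n. f n * z powi n) = (\<Sum>\<^sub>\<infinity>n\<in>F. f n * z powi n)"
    by (rule infsum_cong_neutral) (use assms in auto)
  then show ?thesis using assms by (simp add: fourier_def)
qed

lemma fourier_delta: "fourier (delta k) z = z powi k"
  by (subst fourier_finite_support[of "{k}"]) (auto simp: delta_def)

lemma fourier_norm_le:
  assumes "lp_bounded 1 f M" "norm z = 1" shows "norm (fourier f z) \<le> M"
proof -
  have "norm (fourier f z) \<le> (\<Sum>\<^sub>\<infinity>n. norm (f n * z powi n))"
    unfolding fourier_def using assms lp_bounded_1_D by (intro norm_infsum_bound fourier_abs_summable) auto
  also have "\<dots> = (\<Sum>\<^sub>\<infinity>n. norm (f n))" using assms(2) by (simp add: norm_mult norm_powi_unit)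
  also have "\<dots> \<le> M" using assms by (simp add: lp_bounded_1_infsum_le)
  finally show ?thesis .
qed

lemma infsum_shift: "(\<Sum>\<^sub>\<infinity>n::int. f (n - k)) = (\<Sum>\<^sub>\<infinity>n. f n)"
  by (rule infsum_reindex_bij_witness[of _ "\<lambda>n. n + k" "\<lambda>n. n - k"]) auto

lemma summable_on_shift: "f summable_on UNIV \<Longrightarrow> (\<lambda>n::int. f (n - k)) summable_on UNIV"
  by (subst summable_on_reindex_bij_witness[of _ "\<lambda>n. n + k" "\<lambda>n. n - k" UNIV f]) auto

text \<open>Fubini: splitting z^n as z^k z^(n - k) gives a double family whose absolute values,
  since |z| = 1, sum to the product of the two l^1 norms.\<close>

lemma fourier_conv:
  assumes f: "l1 f" and g: "l1 g" and z: "norm z = 1"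
  shows "fourier (conv f g) z = fourier f z * fourier g z"
proof -
  define h where "h = (\<lambda>k n. (f k * z powi k) * (g (n - k) * z powi (n - k)))"
  have z0: "z \<noteq> 0" using z by auto
  have nh: "norm (h k n) = norm (f k) * norm (g (n - k))" for k n
    using z by (simp add: h_def norm_mult norm_powi_unit)
  have "(\<lambda>x. norm (case x of (k, n) \<Rightarrow> h k n)) summable_on UNIV \<times> UNIV"
    unfolding Infinite_Sum.abs_summable_on_Sigma_iff
  proof (intro conjI ballI)
    show "(\<lambda>n. norm (case (k, n) of (k, n) \<Rightarrow> h k n)) summable_on UNIV" for k
      using summable_on_cmult_right[OF summable_on_shift[OF g, of k], of "norm (f k)"]
      by (simp add: nh)
    have "(\<Sum>\<^sub>\<infinity>n. norm (case (k, n) of (k, n) \<Rightarrow> h k n)) = norm (f k) * (\<Sum>\<^sub>\<infinity>n. norm (g n))" for k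
      by (simp add: nh infsum_cmult_right' infsum_shift[of "\<lambda>n. norm (g n)"])
    then show "(\<lambda>k. norm (\<Sum>\<^sub>\<infinity>n. norm (case (k, n) of (k, n) \<Rightarrow> h k n))) summable_on UNIV"
      using f by (simp add: abs_mult summable_on_cmult_left)
  qed
  then have sm: "(\<lambda>(k, n). h k n) summable_on UNIV \<times> UNIV"
    by (rule abs_summable_summable)
  have "fourier (conv f g) z = (\<Sum>\<^sub>\<infinity>n. \<Sum>\<^sub>\<infinity>k. h k n)"
  proof -
    have "conv f g n * z powi n = (\<Sum>\<^sub>\<infinity>k. h k n)" for n
    proof -
      have "h k n = (f k * g (n - k)) * z powi n" for k
        using power_int_add[of z k "n - k"] z0 by (simp add: h_def)
      then show ?thesis by (simp add: conv_def infsum_cmult_left')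
    qed
    then show ?thesis by (simp add: fourier_def)
  qed
  also have "\<dots> = (\<Sum>\<^sub>\<infinity>k. \<Sum>\<^sub>\<infinity>n. h k n)"
    by (rule infsum_swap_banach[OF sm, symmetric])
  also have "\<dots> = (\<Sum>\<^sub>\<infinity>k. f k * z powi k * fourier g z)"
    by (simp add: h_def infsum_cmult_right' infsum_shift[of "\<lambda>n. g n * z powi n"] fourier_def)
  also have "\<dots> = fourier f z * fourier g z"
    by (simp add: fourier_def infsum_cmult_left')
  finally show ?thesis .
qed

text \<open>The involution of the convolution algebra. On the unit circle it conjugates the Fourier
  series, so \<open>conv v (star v)\<close> represents the square of the modulus of the Fourier
  series of \<open>v\<close>.\<close>

definition star :: "(int \<Rightarrow> complex) \<Rightarrow> int \<Rightarrow> complex" where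
  "star f n = cnj (f (- n))"

lemma fourier_star:
  assumes "norm z = 1" shows "fourier (star f) z = cnj (fourier f z)"
proof -
  have "cnj z = inverse z" using assms
    by (metis complex_cnj_one complex_mod_mult_cnj complex_norm_square inverse_unique mult_1 of_real_1 power_one)
  then have cz: "cnj z powi n = z powi (- n)" for n
    by (simp add: power_int_minus power_int_inverse)
  have "fourier (star f) z = (\<Sum>\<^sub>\<infinity>n. cnj (f n * z powi n))"
    unfolding fourier_def star_def
    by (rule infsum_reindex_bij_witness[of _ uminus uminus]) (auto simp: cz)
  then show ?thesis by (simp only: fourier_def infsum_cnj)
qed

lemma lp_bounded_uminus:
  assumes "lp_bounded p f M"
  shows "lp_bounded p (\<lambda>n. f (- n)) M"
  unfolding lp_bounded_def
proof (intro conjI allI impI)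
  show "0 \<le> M" using assms by (simp add: lp_bounded_def)
  fix F :: "int set" assume F: "finite F"
  have "(\<Sum>n\<in>F. norm (f (- n)) powr p) = (\<Sum>n\<in>uminus ` F. norm (f n) powr p)"
    by (subst sum.reindex) (auto simp: inj_on_def)
  then show "(\<Sum>n\<in>F. norm (f (- n)) powr p) \<le> M powr p"
    using assms F by (auto simp: lp_bounded_def)
qed

lemma fourier_continuous: 
  assumes "l1 f" shows "continuous_on (sphere 0 1) (fourier f)"
proof (rule uniform_limit_theorem)
  show "uniform_limit (sphere 0 1) (\<lambda>F z. \<Sum>n\<in>F. f n * z powi n) (fourier f) (finite_subsets_at_top UNIV)"
    unfolding fourier_def[abs_def]
    by (rule Weierstrass_m_test_general[OF _ assms]) (auto simp: norm_mult norm_powi_unit)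
  show "\<forall>\<^sub>F F in finite_subsets_at_top UNIV. continuous_on (sphere 0 1) (\<lambda>z. \<Sum>n\<in>F. f n * z powi n)"
    by (intro always_eventually allI continuous_intros) auto
qed simp

section \<open>Recovering coefficients by averaging over roots of unity\<close>

lemma sum_cis_roots:
  assumes "0 < \<bar>m\<bar>" "\<bar>m\<bar> < int N"
  shows "(\<Sum>j<N. cis (2 * pi * real j / real N) powi m) = 0"
proof -
  define x where "x = cis (2 * pi * of_int m / real N)"
  have N: "N > 0" using assms by linarith
  have eq: "cis (2 * pi * real j / real N) powi m = x ^ j" for j
    unfolding x_def cis_power_int Complex.DeMoivre by (simp add: field_simps)
  have "x ^ N = 1"
    using N cis_multiple_2pi[of "of_int m"] by (simp add: x_def Complex.DeMoivre)
  moreover have "x \<noteq> 1"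
  proof
    assume "x = 1"
    then have "exp (\<i> * of_real (2 * pi * of_int m / real N)) = 1"
      by (simp add: x_def cis_conv_exp)
    then obtain n :: int where "2 * pi * of_int m / real N = of_int (2 * n) * pi"
      by (auto simp: exp_eq_1)
    then have "real_of_int m = of_int (n * int N)" using N by (simp add: field_simps)
    then have "m = n * int N" by linarith
    then have "int N dvd m" by simp
    then show False using assms zdvd_imp_le[of "int N" "\<bar>m\<bar>"] by auto
  qed
  ultimately show ?thesis
    by (simp add: eq geometric_sum)
qed

text \<open>A discrete stand-in for the Fourier integral: averaging the values times z^(-n) over the
  N-th roots of unity isolates the n-th coefficient exactly once \<open>N\<close> exceeds every |k -
  n|, since then no other frequency in \<open>F\<close> is congruent to n modulo N.\<close>

lemma coeff_le_finite:
  fixes f :: "int \<Rightarrow> complex"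
  assumes F: "finite F" and B: "\<And>z. norm z = 1 \<Longrightarrow> norm (\<Sum>k\<in>F. f k * z powi k) \<le> B" and n: "n \<in> F"
  shows "norm (f n) \<le> B"
proof -
  obtain N :: nat where N: "N > 0" "\<And>k. k \<in> F \<Longrightarrow> \<bar>k - n\<bar> < int N"
  proof
    show "0 < nat (Max ((\<lambda>k. \<bar>k - n\<bar>) ` F)) + 1" by simp
    show "\<bar>k - n\<bar> < int (nat (Max ((\<lambda>k. \<bar>k - n\<bar>) ` F)) + 1)" if "k \<in> F" for k
    proof -
      have "\<bar>k - n\<bar> \<le> Max ((\<lambda>k. \<bar>k - n\<bar>) ` F)"
        using F that by (intro Max_ge) auto
      then show ?thesis by linarith
    qed
  qed
  define \<zeta> where "\<zeta> j = cis (2 * pi * real j / real N)" for j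
  have [simp]: "norm (\<zeta> j) = 1" "\<zeta> j \<noteq> 0" for j by (auto simp: \<zeta>_def)
  have "(\<Sum>j<N. (\<Sum>k\<in>F. f k * \<zeta> j powi k) * \<zeta> j powi (- n)) = (\<Sum>k\<in>F. f k * (\<Sum>j<N. \<zeta> j powi (k - n)))"
    unfolding sum_distrib_left sum_distrib_right
    by (subst sum.swap) (simp add: power_int_diff power_int_minus divide_inverse mult.assoc)
  also have "\<dots> = (\<Sum>k\<in>F. if k = n then of_nat N * f n else 0)"
  proof (rule sum.cong[OF refl])
    fix k assume "k \<in> F"
    then show "f k * (\<Sum>j<N. \<zeta> j powi (k - n)) = (if k = n then of_nat N * f n else 0)"
      using N sum_cis_roots[of "k - n" N] by (auto simp: \<zeta>_def)
  qed
  also have "\<dots> = of_nat N * f n" using F n by simp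
  finally have "real N * norm (f n) = norm (\<Sum>j<N. (\<Sum>k\<in>F. f k * \<zeta> j powi k) * \<zeta> j powi (- n))"
    by (simp add: norm_mult)
  also have "\<dots> \<le> (\<Sum>j<N. B)"
    by (rule sum_norm_le) (auto simp: norm_mult norm_powi_unit intro: B)
  finally show ?thesis using N by simp
qed

text \<open>Truncation with l^1 error \<open>e\<close> changes the values on the circle and the
  coefficients by at most \<open>e\<close>, which reduces the claim to finite sums.\<close>

lemma coeff_le_sup:
  assumes f: "l1 f" and B: "\<And>z. norm z = 1 \<Longrightarrow> norm (fourier f z) \<le> B"
  shows "norm (f n) \<le> B"
proof (rule field_le_epsilon)
  fix e :: real assume e: "e > 0"
  obtain F where F: "finite F" "lp_bounded 1 (\<lambda>n. f n - trunc F f n) e"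
    using lp_bounded_trunc_small[OF _ abs_summable_lp_bounded_1[OF f] e] by auto
  show "norm (f n) \<le> B + e"
  proof (cases "n \<in> F")
    case True
    show ?thesis
    proof (rule coeff_le_finite[OF F(1) _ True])
      fix z :: complex assume z: "norm z = 1"
      have "(\<Sum>k\<in>F. f k * z powi k) = fourier (trunc F f) z"
        by (subst fourier_finite_support[OF F(1)]) (auto simp: trunc_def)
      also have "\<dots> = fourier f z - fourier (\<lambda>n. f n - trunc F f n) z"
        using z f by (simp add: fourier_diff l1_trunc)
      finally show "norm (\<Sum>k\<in>F. f k * z powi k) \<le> B + e"
        using B[OF z] fourier_norm_le[OF F(2) z]
          norm_triangle_ineq4[of "fourier f z" "fourier (\<lambda>n. f n - trunc F f n) z"] by simp
    qed
  next
    case False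
    then have "norm (f n) \<le> e" using lp_bounded_coord[OF _ F(2), of n] by (simp add: trunc_def)
    moreover have "B \<ge> 0" using order_trans[OF norm_ge_zero B[of 1]] by simp
    ultimately show ?thesis by simp
  qed
qed

text \<open>The coefficient bound is applied to f - g with bound 0. Convolution identities are later
  derived from this: both sides are compared on the circle, where convolution is multiplication, so
  associativity and commutativity come for free.\<close>

lemma fourier_inj:
  assumes "l1 f" "l1 g" "\<And>z. norm z = 1 \<Longrightarrow> fourier f z = fourier g z"
  shows "f = g"
proof
  fix n
  have "norm (f n - g n) \<le> 0"
    by (rule coeff_le_sup[OF l1_diff[OF assms(1,2)]]) (use assms in \<open>simp add: fourier_diff\<close>)
  then show "f n = g n" by simp
qed

section \<open>Differentiation of Fourier series\<close>

definition deriv_seq :: "(int \<Rightarrow> complex) \<Rightarrow> int \<Rightarrow> complex" where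
  "deriv_seq f n = of_int n * f n"

lemma norm_cis_minus_1_le: "norm (cis x - 1) \<le> \<bar>x\<bar>"
proof -
  have "norm (cis x - 1) = 2 * \<bar>sin (x / 2)\<bar>"
    using dist_exp_i_1[of x] by (simp add: cis_conv_exp dist_norm)
  also have "\<dots> \<le> 2 * \<bar>x / 2\<bar>" using abs_sin_x_le_abs_x[of "x/2"] by linarith
  finally show ?thesis by simp
qed

lemma has_vector_derivative_iff_quotient:
  fixes f :: "real \<Rightarrow> complex"
  shows "(f has_vector_derivative D) (at t) \<longleftrightarrow> ((\<lambda>h. (f (t + h) - f t) / of_real h) \<longlongrightarrow> D) (at 0)"
proof -
  have "norm (f (t + h) - f t - h *\<^sub>R D) / norm h = norm ((f (t + h) - f t) / of_real h - D)" if "h \<noteq> 0" for h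
  proof -
    have "(f (t + h) - f t) / of_real h - D = (f (t + h) - f t - h *\<^sub>R D) / of_real h"
      using that by (simp add: field_simps scaleR_conv_of_real)
    then show ?thesis by (simp add: norm_divide)
  qed
  then have "((\<lambda>h. norm (f (t + h) - f t - h *\<^sub>R D) / norm h) \<longlongrightarrow> 0) (at 0) \<longleftrightarrow>
     ((\<lambda>h. norm ((f (t + h) - f t) / of_real h - D)) \<longlongrightarrow> 0) (at 0)"
    by (intro Lim_cong_within) auto
  then show ?thesis
    unfolding has_vector_derivative_def has_derivative_at tendsto_norm_zero_iff LIM_zero_iff
    by (simp add: bounded_linear_scaleR_left)
qed

text \<open>On the Fourier side \<open>deriv_seq\<close> is -\<i> d/dt along t \<mapsto>
  \<open>cis t\<close>. The difference quotient of the n-th term is dominated by |n f_n| uniformly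
  in the increment, so the M-test lets the limit be taken termwise.\<close>

lemma fourier_has_vector_derivative:
  assumes f: "l1 f" and Df: "l1 (deriv_seq f)"
  shows "((\<lambda>t. fourier f (cis t)) has_vector_derivative \<i> * fourier (deriv_seq f) (cis t)) (at t)"
proof -
  define q where "q n h = f n * cis t powi n * ((cis (of_int n * h) - 1) / of_real h)" for n h
  have quot: "(\<Sum>\<^sub>\<infinity>n. q n h) = (fourier f (cis (t + h)) - fourier f (cis t)) / of_real h" for h
  proof -
    have cis: "cis (t + h) powi n = cis t powi n * cis (of_int n * h)" for n
      by (simp add: cis_power_int cis_mult distrib_left)
    have "(\<Sum>\<^sub>\<infinity>n. q n h) = (\<Sum>\<^sub>\<infinity>n. f n * cis (t + h) powi n - f n * cis t powi n) / of_real h"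
      unfolding q_def divide_inverse infsum_cmult_left'[symmetric]
      by (rule infsum_cong) (simp add: cis left_diff_distrib right_diff_distrib mult.assoc)
    also have "(\<Sum>\<^sub>\<infinity>n. f n * cis (t + h) powi n - f n * cis t powi n) = fourier f (cis (t + h)) - fourier f (cis t)"
      unfolding fourier_def
      using infsum_add[of "\<lambda>n. f n * cis (t + h) powi n" UNIV "\<lambda>n. - (f n * cis t powi n)"]
        fourier_summable[OF f, of "cis (t + h)"] fourier_summable[OF f, of "cis t"]
      by (simp add: infsum_uminus summable_on_uminus)
    finally show ?thesis .
  qed
  have "((\<lambda>h. \<Sum>\<^sub>\<infinity>n. q n h) \<longlongrightarrow> \<i> * fourier (deriv_seq f) (cis t)) (at 0)"
  proof (rule swap_uniform_limit)
    show "uniform_limit UNIV (\<lambda>F h. \<Sum>n\<in>F. q n h) (\<lambda>h. \<Sum>\<^sub>\<infinity>n. q n h) (finite_subsets_at_top UNIV)"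
    proof (rule Weierstrass_m_test_general[OF _ Df])
      fix n h
      show "norm (q n h) \<le> norm (deriv_seq f n)"
      \<comment> \<open>At h = 0 the quotient is 0 by the convention for division by zero, so the
        domination holds for every h.\<close>
      proof (cases "h = 0")
        case False
        then have "norm ((cis (of_int n * h) - 1) / of_real h) \<le> \<bar>of_int n\<bar>"
          using norm_cis_minus_1_le[of "of_int n * h"]
          by (simp add: norm_divide divide_le_eq abs_mult)
        then have "norm (f n) * norm ((cis (of_int n * h) - 1) / of_real h) \<le> norm (f n) * \<bar>of_int n\<bar>"
          by (rule mult_left_mono) simp
        then show ?thesis
          unfolding q_def deriv_seq_def norm_mult by (simp add: norm_powi_unit mult.commute)
      qed (simp add: q_def)
    qed
    show "\<forall>\<^sub>F F in finite_subsets_at_top UNIV. ((\<lambda>h. \<Sum>n\<in>F. q n h) \<longlongrightarrow> (\<Sum>n\<in>F. \<i> * (deriv_seq f n * cis t powi n))) (at 0)"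
    proof (intro always_eventually allI tendsto_sum)
      fix n
      have "((\<lambda>h. cis (of_int n * h)) has_vector_derivative (of_int n * (\<i> * cis (of_int n * 0)))) (at 0)"
        unfolding has_vector_derivative_def
        by (auto intro!: derivative_eq_intros simp: scaleR_conv_of_real)
      then have "((\<lambda>h. (cis (of_int n * h) - 1) / of_real h) \<longlongrightarrow> of_int n * \<i>) (at 0)"
        by (simp add: has_vector_derivative_iff_quotient)
      then have "((\<lambda>h. q n h) \<longlongrightarrow> f n * cis t powi n * (of_int n * \<i>)) (at 0)"
        unfolding q_def by (intro tendsto_intros)
      then show "((\<lambda>h. q n h) \<longlongrightarrow> \<i> * (deriv_seq f n * cis t powi n)) (at 0)"
        by (simp add: deriv_seq_def mult_ac)
    qed
    show "((\<lambda>F. \<Sum>n\<in>F. \<i> * (deriv_seq f n * cis t powi n)) \<longlongrightarrow> \<i> * fourier (deriv_seq f) (cis t)) (finite_subsets_at_top UNIV)"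
      unfolding sum_distrib_left[symmetric] fourier_def
      by (intro tendsto_intros infsum_tendsto fourier_summable Df) auto
  qed simp
  then have "((\<lambda>h. (fourier f (cis (t + h)) - fourier f (cis t)) / of_real h) \<longlongrightarrow> \<i> * fourier (deriv_seq f) (cis t)) (at 0)"
    by (simp add: quot)
  then show ?thesis
    by (simp add: has_vector_derivative_iff_quotient)
qed

section \<open>Weighted spaces\<close>

text \<open>Taking the maximum before the power makes the weights multiplicative in the exponent,
  \<open>wt (i + k) n = wt i n * wt k n\<close>; agreement with the given weight is
  \<open>weight_eq_wt\<close>.\<close>

definition wt :: "nat \<Rightarrow> int \<Rightarrow> real" where
  "wt j n = max 1 (real_of_int \<bar>n\<bar>) ^ j"

lemma wt_ge_1: "wt j n \<ge> 1"
  by (simp add: wt_def)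

lemma wt_mono: "i \<le> j \<Longrightarrow> wt i n \<le> wt j n"
  by (simp add: wt_def power_increasing)

lemma wt_submult: "wt j n \<le> 2 ^ j * wt j k * wt j (n - k)"
proof -
  define x y where "x = max 1 (real_of_int \<bar>k\<bar>)" and "y = max 1 (real_of_int \<bar>n - k\<bar>)"
  have "x \<ge> 1" "y \<ge> 1" by (auto simp: x_def y_def)
  then have "x * 1 \<le> x * y" "1 * y \<le> x * y" by (auto intro: mult_mono)
  moreover have "max 1 (real_of_int \<bar>n\<bar>) \<le> x + y" by (auto simp: x_def y_def max_def)
  ultimately have "max 1 (real_of_int \<bar>n\<bar>) \<le> 2 * x * y" by linarith
  then have "max 1 (real_of_int \<bar>n\<bar>) ^ j \<le> (2 * x * y) ^ j" by (intro power_mono) auto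
  then show ?thesis by (simp add: wt_def x_def y_def power_mult_distrib)
qed

text \<open>The larger of |k| and |n - k| is at least |n| / 2. Unlike in \<open>wt_submult\<close>,
  each summand puts the weight on one factor only; the other factor of a convolution then needs just
  an unweighted l^1 bound.\<close>

lemma wt_subadd: "wt j n \<le> 2 ^ j * (wt j k + wt j (n - k))"
proof -
  define x y where "x = max 1 (real_of_int \<bar>k\<bar>)" and "y = max 1 (real_of_int \<bar>n - k\<bar>)"
  have xy: "x \<ge> 1" "y \<ge> 1" by (auto simp: x_def y_def)
  have "real_of_int \<bar>n\<bar> \<le> real_of_int \<bar>k\<bar> + real_of_int \<bar>n - k\<bar>" by linarith
  then have "max 1 (real_of_int \<bar>n\<bar>) \<le> 2 * max x y"
    unfolding x_def y_def max_def by (auto simp del: of_int_abs of_int_diff)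
  then have "max 1 (real_of_int \<bar>n\<bar>) ^ j \<le> (2 * max x y) ^ j" by (intro power_mono) auto
  also have "\<dots> = 2 ^ j * max x y ^ j" by (simp add: power_mult_distrib)
  also have "max x y ^ j \<le> x ^ j + y ^ j" using xy by (auto simp: max_def)
  finally show ?thesis by (simp add: wt_def x_def y_def)
qed

lemma weight_eq_wt: "weight a n = wt (nat a) n"
proof (cases "n = 0")
  case False
  then have "1 \<le> real_of_int \<bar>n\<bar>" by simp
  then show ?thesis by (simp add: weight_def wt_def max_def)
qed (auto simp: weight_def wt_def power_0_left)

definition weighted_bounded :: "real \<Rightarrow> nat \<Rightarrow> (int \<Rightarrow> complex) \<Rightarrow> real \<Rightarrow> bool" where
  "weighted_bounded p j f M \<longleftrightarrow> lp_bounded p (\<lambda>n. f n * of_real (wt j n)) M"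

lemma lp_weighted_eq: "lp_weighted p a = {f. (\<lambda>n. f n * of_real (wt (nat a) n)) \<in> lp_space p}"
proof -
  have "\<bar>wt (nat a) n\<bar> = wt (nat a) n" for n using wt_ge_1[of "nat a" n] by simp
  then show ?thesis by (simp add: lp_weighted_def lp_space_def weight_eq_wt norm_mult)
qed

lemma lp_weighted_iff: "p \<ge> 1 \<Longrightarrow> f \<in> lp_weighted p a \<longleftrightarrow> (\<exists>M. weighted_bounded p (nat a) f M)"
  by (simp add: lp_weighted_eq lp_space_iff_bounded weighted_bounded_def)

lemma norm_times_wt: "norm (x * complex_of_real (wt j n)) = norm x * wt j n"
  using wt_ge_1[of j n] by (simp add: norm_mult)

lemma weighted_bounded_nonneg: "weighted_bounded p j f M \<Longrightarrow> M \<ge> 0"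
  by (simp add: weighted_bounded_def lp_bounded_nonneg)

lemma weighted_bounded_mono:
  assumes "p \<ge> 1" "weighted_bounded p j f M" "i \<le> j" "M \<le> N" shows "weighted_bounded p i f N"
  unfolding weighted_bounded_def
  by (rule lp_bounded_mono[OF assms(1) assms(2)[unfolded weighted_bounded_def] _ assms(4)])
     (simp add: norm_times_wt wt_mono[OF assms(3)] mult_left_mono)

lemma weighted_bounded_0: "weighted_bounded p 0 f M \<longleftrightarrow> lp_bounded p f M"
  by (simp add: weighted_bounded_def wt_def)

lemma weighted_bounded_lp_bounded: "p \<ge> 1 \<Longrightarrow> weighted_bounded p j f M \<Longrightarrow> lp_bounded p f M"
  using weighted_bounded_mono[of p j f M 0 M] by (simp add: weighted_bounded_0)

lemma weighted_bounded_add: "p \<ge> 1 \<Longrightarrow> weighted_bounded p j f M \<Longrightarrow> weighted_bounded p j g N \<Longrightarrow> weighted_bounded p j (\<lambda>n. f n + g n) (M + N)"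
  unfolding weighted_bounded_def distrib_right by (rule lp_bounded_add)

lemma weighted_bounded_diff: "p \<ge> 1 \<Longrightarrow> weighted_bounded p j f M \<Longrightarrow> weighted_bounded p j g N \<Longrightarrow> weighted_bounded p j (\<lambda>n. f n - g n) (M + N)"
  unfolding weighted_bounded_def left_diff_distrib by (rule lp_bounded_diff)

lemma weighted_bounded_scale: "p \<ge> 1 \<Longrightarrow> weighted_bounded p j f M \<Longrightarrow> weighted_bounded p j (\<lambda>n. c * f n) (norm c * M)"
  unfolding weighted_bounded_def mult.assoc by (rule lp_bounded_scale)

lemma weighted_bounded_finite_support:
  assumes "p \<ge> 1" "finite F" "\<And>n. n \<notin> F \<Longrightarrow> f n = 0"
  shows "\<exists>M. weighted_bounded p j f M"
proof -
  have "(\<lambda>n. f n * of_real (wt j n)) = trunc F (\<lambda>n. f n * of_real (wt j n))"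
    using assms by (auto simp: trunc_def)
  moreover have "lp_bounded p (trunc F (\<lambda>n. f n * of_real (wt j n))) (\<Sum>k\<in>F. norm (f k * of_real (wt j k)) * 1)"
    unfolding trunc_eq_sum[OF assms(2)]
    by (intro lp_bounded_sum lp_bounded_scale lp_bounded_delta assms)
  ultimately show ?thesis unfolding weighted_bounded_def by auto
qed

lemma weighted_bounded_delta: "p \<ge> 1 \<Longrightarrow> \<exists>M. weighted_bounded p j (delta k) M"
  by (rule weighted_bounded_finite_support[of p "{k}"]) (auto simp: delta_def)

lemma weighted_bounded_star: "p \<ge> 1 \<Longrightarrow> weighted_bounded p j f M \<Longrightarrow> weighted_bounded p j (star f) M"
  unfolding weighted_bounded_def
  by (drule lp_bounded_uminus, erule lp_bounded_mono[rotated])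
     (simp_all add: norm_times_wt star_def, simp add: wt_def)

lemma weighted_bounded_suminf:
  assumes p: "p \<ge> 1" and f: "\<And>i::nat. weighted_bounded p j (f i) (M i)" and M: "summable M"
  shows "summable (\<lambda>i. f i n)" "weighted_bounded p j (\<lambda>n. \<Sum>i. f i n) (suminf M)"
proof -
  show *: "summable (\<lambda>i. f i n)" for n
    by (rule lp_bounded_suminf(1)[OF p weighted_bounded_lp_bounded[OF p f] M])
  have "lp_bounded p (\<lambda>n. \<Sum>i. f i n * of_real (wt j n)) (suminf M)"
    by (rule lp_bounded_suminf(2)[OF p f[unfolded weighted_bounded_def] M])
  moreover have "(\<Sum>i. f i n * of_real (wt j n)) = (\<Sum>i. f i n) * of_real (wt j n)" for n
    by (rule suminf_mult2[symmetric, OF *])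
  ultimately show "weighted_bounded p j (\<lambda>n. \<Sum>i. f i n) (suminf M)" by (simp add: weighted_bounded_def)
qed

lemma weighted_bounded_tendsto:
  assumes p: "p \<ge> 1" and F: "F \<noteq> bot" and lim: "\<And>n. ((\<lambda>i. f i n) \<longlongrightarrow> g n) F"
    and bnd: "eventually (\<lambda>i. weighted_bounded p j (f i) M) F"
  shows "weighted_bounded p j g M"
  unfolding weighted_bounded_def
  by (rule lp_bounded_tendsto[OF p F _ bnd[unfolded weighted_bounded_def]]) (rule tendsto_mult_right[OF lim])

lemma weighted_bounded_trunc_small:
  assumes "p \<ge> 1" "weighted_bounded p j f M" "e > 0"
  shows "\<exists>F. finite F \<and> weighted_bounded p j (\<lambda>n. f n - trunc F f n) e"
proof -
  obtain F where "finite F"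
    and F: "lp_bounded p (\<lambda>n. f n * of_real (wt j n) - trunc F (\<lambda>n. f n * of_real (wt j n)) n) e"
    using lp_bounded_trunc_small[OF assms(1) assms(2)[unfolded weighted_bounded_def] assms(3)] by blast
  moreover have "(\<lambda>n. f n * of_real (wt j n) - trunc F (\<lambda>n. f n * of_real (wt j n)) n) =
     (\<lambda>n. (f n - trunc F f n) * of_real (wt j n))"
    by (auto simp: trunc_def)
  ultimately show ?thesis unfolding weighted_bounded_def by auto
qed

section \<open>The embedding into l^1 and the algebra property\<close>

lemma sum_nat_abs_le:
  fixes g :: "nat \<Rightarrow> real"
  assumes "summable g" "\<And>n. g n \<ge> 0" "finite F"
  shows "(\<Sum>n\<in>F. g (nat \<bar>n\<bar>)) \<le> 2 * suminf g"
proof -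
  have *: "(\<Sum>n\<in>G. g (nat \<bar>n\<bar>)) \<le> suminf g" if "finite G" "inj_on (\<lambda>n. nat \<bar>n\<bar>) G" for G
    using sum_le_suminf[OF assms(1), of "(\<lambda>n. nat \<bar>n\<bar>) ` G"] that assms(2) by (simp add: sum.reindex)
  have "(\<Sum>n\<in>F. g (nat \<bar>n\<bar>)) = (\<Sum>n\<in>F \<inter> {0..}. g (nat \<bar>n\<bar>)) + (\<Sum>n\<in>F \<inter> {..<0}. g (nat \<bar>n\<bar>))"
    using assms(3) by (subst sum.union_disjoint[symmetric]) (auto intro!: sum.cong)
  also have "\<dots> \<le> suminf g + suminf g"
    using assms(3) by (intro add_mono *) (auto simp: inj_on_def)
  finally show ?thesis by simp
qed

definition abs_seq :: "(int \<Rightarrow> complex) \<Rightarrow> int \<Rightarrow> complex" where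
  "abs_seq f n = of_real (norm (f n))"

text \<open>The weighted convolution is dominated coefficientwise by the sum of two convolutions of
  absolute values, each with one factor in l^1 and one in l^p, so Young's inequality applies to
  both. The roles of left and right factor differ in the two products, matching the two summands of
  \<open>wt_subadd\<close>; choosing \<open>F2\<close> and \<open>G2\<close> zero leaves a single
  product.\<close>

lemma conv_weight_bound:
  assumes p: "p \<ge> 1"
    and dom: "\<And>k n. norm (f k) * norm (g (n - k)) * w n \<le>
       norm (F1 k) * norm (G1 (n - k)) + norm (F2 k) * norm (G2 (n - k))"
    and w: "\<And>n. w n \<ge> 1"
    and F1: "lp_bounded 1 F1 L1" and G1: "lp_bounded p G1 M1"
    and G2: "lp_bounded 1 G2 L2" and F2: "lp_bounded p F2 M2"
  shows "lp_bounded p (\<lambda>n. conv f g n * of_real (w n)) (L1 * M1 + L2 * M2)"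
proof -
  have a: "lp_bounded q (abs_seq h) M" if "q \<ge> 1" "lp_bounded q h M" for q h M
    by (rule lp_bounded_mono[OF that]) (auto simp: abs_seq_def)
  have c: "lp_bounded p (\<lambda>n. conv (abs_seq F1) (abs_seq G1) n + conv (abs_seq G2) (abs_seq F2) n) (L1 * M1 + L2 * M2)"
    by (intro lp_bounded_add lp_bounded_conv p a F1 F2 G1 G2) auto
  have s1: "(\<lambda>k. norm (F1 k) * norm (G1 (n - k))) summable_on UNIV" for n
    using lp_bounded_conv_summable[OF p G1 lp_bounded_1_D[OF F1], of n] by (simp add: norm_mult)
  have s2': "(\<lambda>k. norm (G2 k) * norm (F2 (n - k))) summable_on UNIV" for n
    using lp_bounded_conv_summable[OF p F2 lp_bounded_1_D[OF G2], of n] by (simp add: norm_mult)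
  have s2: "(\<lambda>k. norm (F2 k) * norm (G2 (n - k))) summable_on UNIV" for n
    using s2'[of n] by (subst summable_on_reindex_bij_witness[of _ "\<lambda>k. n - k" "\<lambda>k. n - k" UNIV
      "\<lambda>k. norm (G2 k) * norm (F2 (n - k))"]) auto
  have e1: "conv (abs_seq F1) (abs_seq G1) n = of_real (\<Sum>\<^sub>\<infinity>k. norm (F1 k) * norm (G1 (n - k)))" for n
    unfolding conv_def abs_seq_def of_real_mult[symmetric]
    by (rule infsumI[OF has_sum_of_real[OF has_sum_infsum[OF s1]]])
  have e2: "conv (abs_seq G2) (abs_seq F2) n = of_real (\<Sum>\<^sub>\<infinity>k. norm (F2 k) * norm (G2 (n - k)))" for n
    unfolding conv_commute[of "abs_seq G2"] unfolding conv_def abs_seq_def of_real_mult[symmetric]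
    by (rule infsumI[OF has_sum_of_real[OF has_sum_infsum[OF s2]]])
  show ?thesis
  proof (rule lp_bounded_mono[OF p c])
    fix n
    define R where "R k = norm (F1 k) * norm (G1 (n - k)) + norm (F2 k) * norm (G2 (n - k))" for k
    have R: "R summable_on UNIV" unfolding R_def by (intro summable_on_add s1 s2)
    have wn: "w n \<ge> 1" by (rule w)
    have dom': "norm (f k * g (n - k) * of_real (w n)) \<le> R k" for k
      using dom[of k n] wn by (simp add: norm_mult R_def)
    have sm: "(\<lambda>k. norm (f k * g (n - k) * of_real (w n))) summable_on UNIV"
      by (rule summable_on_comparison_test[OF R]) (use dom' in auto)
    have "norm (conv f g n * of_real (w n)) = norm (\<Sum>\<^sub>\<infinity>k. f k * g (n - k) * of_real (w n))"
      by (simp add: conv_def infsum_cmult_left')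
    also have "\<dots> \<le> (\<Sum>\<^sub>\<infinity>k. norm (f k * g (n - k) * of_real (w n)))"
      by (rule norm_infsum_bound[OF sm])
    also have "\<dots> \<le> (\<Sum>\<^sub>\<infinity>k. R k)" by (rule infsum_mono[OF sm R dom'])
    also have "\<dots> = (\<Sum>\<^sub>\<infinity>k. norm (F1 k) * norm (G1 (n - k))) + (\<Sum>\<^sub>\<infinity>k. norm (F2 k) * norm (G2 (n - k)))"
      unfolding R_def by (rule infsum_add[OF s1 s2])
    also have "\<dots> \<le> norm (conv (abs_seq F1) (abs_seq G1) n + conv (abs_seq G2) (abs_seq F2) n)"
      unfolding e1 e2 of_real_add[symmetric] norm_of_real by simp
    finally show "norm (conv f g n * of_real (w n)) \<le> norm (conv (abs_seq F1) (abs_seq G1) n + conv (abs_seq G2) (abs_seq F2) n)" .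
  qed simp
qed

lemma weighted_bounded_conv_multiplier:
  assumes p: "p \<ge> 1" and f: "lp_bounded 1 (\<lambda>n. f n * of_real (wt j n)) L" and g: "weighted_bounded p j g M"
  shows "weighted_bounded p j (conv f g) (2 ^ j * (L * M))"
proof -
  have "lp_bounded p (\<lambda>n. conv f g n * of_real (wt j n)) ((2 ^ j * L) * M + 0 * 0)"
  proof (rule conv_weight_bound[OF p _ wt_ge_1 _ g[unfolded weighted_bounded_def] lp_bounded_zero lp_bounded_zero])
    show "lp_bounded 1 (\<lambda>n. of_real (2 ^ j) * (f n * of_real (wt j n))) (2 ^ j * L)"
      using lp_bounded_scale[OF _ f, of "of_real (2 ^ j)"] by (simp add: norm_power)
    fix k n
    have "norm (f k) * norm (g (n - k)) * wt j n \<le> norm (f k) * norm (g (n - k)) * (2 ^ j * wt j k * wt j (n - k))"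
      by (intro mult_left_mono wt_submult) auto
    then show "norm (f k) * norm (g (n - k)) * wt j n \<le> norm (of_real (2 ^ j) * (f k * of_real (wt j k))) *
        norm (g (n - k) * of_real (wt j (n - k))) + norm (0::complex) * norm (0::complex)"
      unfolding norm_times_wt norm_mult[of "of_real (2 ^ j)"] by (simp add: norm_power mult_ac)
  qed
  then show ?thesis by (simp add: weighted_bounded_def mult.assoc)
qed

text \<open>The condition \<open>pj\<close> places the weighted space inside l^1: for p > 1 one
  power of the weight suffices, because 1 / max 1 |n| lies in l^q for the conjugate exponent q >
  1.\<close>

locale weighted_lp =
  fixes p :: real and j :: nat
  assumes p: "p \<ge> 1" and pj: "p = 1 \<or> j \<ge> 1"
begin

text \<open>Hoelder's inequality with the conjugate exponent, obtained termwise from Young's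
  inequality x y \<le> x^p / p + y^q / q with x = |f_n| \<open>wt 1 n\<close> / M and y = 1 /
  \<open>wt 1 n\<close>.\<close>

lemma weighted_bounded_l1_ex: "\<exists>K>0. \<forall>f M. weighted_bounded p j f M \<longrightarrow> lp_bounded 1 f (K * M)"
proof (cases "p = 1")
  case True
  then show ?thesis using weighted_bounded_lp_bounded[OF p] by (intro exI[of _ 1]) auto
next
  case False
  then have p1: "p > 1" and j1: "j \<ge> 1" using p pj by auto
  define q where "q = p / (p - 1)"
  have q: "q > 1" "1 / p + 1 / q = 1" using p1 by (auto simp: q_def field_simps)
  define u where "u n = max 1 (real n) powr (- q)" for n :: nat
  have "summable (\<lambda>n. real n powr (- q))" using q by (simp add: summable_real_powr_iff)
  moreover have "eventually (\<lambda>n. real n powr (- q) = u n) sequentially"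
    using eventually_ge_at_top[of 1] by eventually_elim (simp add: u_def max_def)
  ultimately have u: "summable u" by (simp cong: summable_cong)
  have u0: "u n \<ge> 0" for n by (simp add: u_def)
  \<comment> \<open>The 1 bounds the normalised sum of p-th powers; the factor 2 counts positive and
    negative indices.\<close>
  define K where "K = 1 + 2 * suminf u"
  have K: "K > 0" using suminf_nonneg[OF u u0] by (simp add: K_def)
  have "lp_bounded 1 f (K * M)" if f: "weighted_bounded p j f M" for f M
  proof (cases "M = 0")
    case True
    then have "f n = 0" for n using lp_bounded_coord[OF p weighted_bounded_lp_bounded[OF p f], of n] by simp
    then show ?thesis using True by (simp add: lp_bounded_1_iff)
  next
    case False
    then have M: "M > 0" using weighted_bounded_nonneg[OF f] by simp
    have f1: "lp_bounded p (\<lambda>n. f n * of_real (wt 1 n)) M"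
      using weighted_bounded_mono[OF p f j1 order_refl] by (simp add: weighted_bounded_def)
    show ?thesis unfolding lp_bounded_1_iff
    proof (intro conjI allI impI)
      show "0 \<le> K * M" using K M by simp
      fix F :: "int set" assume F: "finite F"
      have *: "norm (f n) \<le> M * (norm (f n * of_real (wt 1 n)) powr p / M powr p + u (nat \<bar>n\<bar>))" for n
      proof -
        define x y where "x = norm (f n) * wt 1 n / M" and "y = 1 / wt 1 n"
        have w: "wt 1 n \<ge> 1" by (rule wt_ge_1)
        have xy: "x \<ge> 0" "y \<ge> 0" using M w by (auto simp: x_def y_def)
        have "x * y \<le> x powr p / p + y powr q / q"
          using Youngs_inequality[of p q x y] xy p1 q by simp
        also have "\<dots> \<le> x powr p + y powr q"
          using p1 q xy by (intro add_mono) (auto simp: divide_le_eq mult_le_cancel_left1)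
        also have "x powr p = norm (f n * of_real (wt 1 n)) powr p / M powr p"
          using M w unfolding norm_times_wt x_def by (intro powr_divide)
        also have "y powr q = u (nat \<bar>n\<bar>)"
          by (simp add: y_def u_def wt_def powr_minus_divide powr_divide)
        finally have "M * (x * y) \<le> M * (norm (f n * of_real (wt 1 n)) powr p / M powr p + u (nat \<bar>n\<bar>))"
          using M by (intro mult_left_mono) auto
        moreover have "M * (x * y) = norm (f n)" using M w by (simp add: x_def y_def)
        ultimately show ?thesis by simp
      qed
      have "(\<Sum>n\<in>F. norm (f n)) \<le> (\<Sum>n\<in>F. M * (norm (f n * of_real (wt 1 n)) powr p / M powr p + u (nat \<bar>n\<bar>)))"
        by (intro sum_mono *)
      also have "\<dots> = M * ((\<Sum>n\<in>F. norm (f n * of_real (wt 1 n)) powr p) / M powr p + (\<Sum>n\<in>F. u (nat \<bar>n\<bar>)))"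
        unfolding sum_distrib_left[symmetric] sum.distrib sum_divide_distrib by (rule refl)
      also have "\<dots> \<le> M * (1 + 2 * suminf u)"
        using M F f1 by (intro mult_left_mono add_mono sum_nat_abs_le u u0) (auto simp: lp_bounded_def divide_le_eq_1)
      finally show "(\<Sum>n\<in>F. norm (f n)) \<le> K * M" by (simp add: K_def mult.commute)
    qed
  qed
  then show ?thesis using K by blast
qed

definition K where "K = (SOME K. K > 0 \<and> (\<forall>f M. weighted_bounded p j f M \<longrightarrow> lp_bounded 1 f (K * M)))"

lemma K_pos: "K > 0" and weighted_bounded_l1_bound: "weighted_bounded p j f M \<Longrightarrow> lp_bounded 1 f (K * M)"
  using someI_ex[OF weighted_bounded_l1_ex] unfolding K_def by auto

lemma weighted_bounded_l1: "weighted_bounded p j f M \<Longrightarrow> l1 f"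
  using weighted_bounded_l1_bound lp_bounded_1_D by blast

text \<open>The constant of the algebra inequality: \<open>2 ^ j\<close> comes from
  \<open>wt_subadd\<close>, the factor 2 from its two summands, and \<open>K\<close> from the
  embedding into l^1.\<close>

definition C where "C = 2 ^ j * 2 * K"

lemma C_pos: "C > 0" using K_pos by (simp add: C_def)

lemma weighted_bounded_conv:
  assumes f: "weighted_bounded p j f M" and g: "weighted_bounded p j g N"
  shows "weighted_bounded p j (conv f g) (C * M * N)"
proof -
  have sc: "lp_bounded q (\<lambda>n. of_real (2 ^ j) * h n) (2 ^ j * B)" if "q \<ge> 1" "lp_bounded q h B" for q h B
    using lp_bounded_scale[OF that, of "of_real (2 ^ j)"] by (simp add: norm_power)
  have "lp_bounded p (\<lambda>n. conv f g n * of_real (wt j n)) ((2 ^ j * (K * M)) * N + (2 ^ j * (K * N)) * M)"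
  proof (rule conv_weight_bound[OF p _ wt_ge_1])
    show "lp_bounded 1 (\<lambda>n. of_real (2 ^ j) * f n) (2 ^ j * (K * M))"
      by (intro sc weighted_bounded_l1_bound f) simp
    show "lp_bounded 1 (\<lambda>n. of_real (2 ^ j) * g n) (2 ^ j * (K * N))"
      by (intro sc weighted_bounded_l1_bound g) simp
    show "lp_bounded p (\<lambda>n. f n * of_real (wt j n)) M" "lp_bounded p (\<lambda>n. g n * of_real (wt j n)) N"
      using f g by (auto simp: weighted_bounded_def)
    fix k n
    have "norm (f k) * norm (g (n - k)) * wt j n \<le> norm (f k) * norm (g (n - k)) * (2 ^ j * (wt j k + wt j (n - k)))"
      by (intro mult_left_mono wt_subadd) auto
    then show "norm (f k) * norm (g (n - k)) * wt j n \<le>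
       norm (of_real (2 ^ j) * f k) * norm (g (n - k) * of_real (wt j (n - k))) +
       norm (f k * of_real (wt j k)) * norm (of_real (2 ^ j) * g (n - k))"
      unfolding norm_times_wt norm_mult[of "of_real (2 ^ j)"] by (simp add: norm_power algebra_simps)
  qed
  then show ?thesis by (simp add: weighted_bounded_def C_def mult_ac)
qed

end

section \<open>Spectral radius and Wiener's lemma\<close>

fun cpow :: "(int \<Rightarrow> complex) \<Rightarrow> nat \<Rightarrow> int \<Rightarrow> complex" where
  "cpow f 0 = delta 0"
| "cpow f (Suc n) = conv f (cpow f n)"

lemma l1_cpow: "l1 f \<Longrightarrow> l1 (cpow f n)"
  by (induction n) (auto simp: l1_delta intro: l1_conv)

lemma fourier_cpow: "l1 f \<Longrightarrow> norm z = 1 \<Longrightarrow> fourier (cpow f n) z = fourier f z ^ n"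
  by (induction n) (auto simp: fourier_delta fourier_conv l1_cpow)

text \<open>Restricted to the unit circle, the Fourier series of \<open>dilate s f\<close> is that
  of \<open>f\<close> on the circle of radius \<open>s\<close>. Dilation respects convolution, so
  powers can be estimated on other circles.\<close>

definition dilate :: "real \<Rightarrow> (int \<Rightarrow> complex) \<Rightarrow> int \<Rightarrow> complex" where
  "dilate s f n = f n * of_real (s powi n)"

lemma dilate_conv:
  assumes "s \<noteq> 0" shows "conv (dilate s f) (dilate s g) = dilate s (conv f g)"
proof
  fix n
  have "dilate s f k * dilate s g (n - k) = f k * g (n - k) * of_real (s powi n)" for k
    using power_int_add[of s k "n - k"] assms by (simp add: dilate_def)
  then show "conv (dilate s f) (dilate s g) n = dilate s (conv f g) n"
    unfolding conv_def by (simp only: infsum_cmult_left' dilate_def)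
qed

lemma dilate_cpow: "s \<noteq> 0 \<Longrightarrow> cpow (dilate s f) n = dilate s (cpow f n)"
proof (induction n)
  case 0
  then show ?case by (auto simp: dilate_def delta_def)
qed (simp add: dilate_conv)

text \<open>A Laurent polynomial is continuous away from 0, so its supremum on circles of radius
  near 1 exceeds the one on the unit circle by at most \<open>e\<close>; the sum \<open>D s\<close>
  measures the deviation independently of the point of the circle.\<close>

lemma dilation_near_1:
  assumes F: "finite F" "\<And>n. n \<notin> F \<Longrightarrow> P n = 0" and e: "e > 0"
    and rho: "\<And>z. norm z = 1 \<Longrightarrow> norm (fourier P z) \<le> \<rho>"
  obtains r where "r > 1"
    "\<And>z s. norm z = 1 \<Longrightarrow> s = r \<or> s = inverse r \<Longrightarrow> norm (fourier (dilate s P) z) \<le> \<rho> + e"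
proof -
  define D where "D s = (\<Sum>k\<in>F. norm (P k) * \<bar>s powi k - 1\<bar>)" for s :: real
  have "(D \<longlongrightarrow> (\<Sum>k\<in>F. norm (P k) * \<bar>1 powi k - 1\<bar>)) (at_right 1)"
    unfolding D_def by (intro tendsto_intros) auto
  then have 1: "eventually (\<lambda>s. D s < e) (at_right 1)"
    using e by (intro order_tendstoD) auto
  have "((\<lambda>s. D (inverse s)) \<longlongrightarrow> (\<Sum>k\<in>F. norm (P k) * \<bar>inverse 1 powi k - 1\<bar>)) (at_right 1)"
    unfolding D_def by (intro tendsto_intros) auto
  then have 2: "eventually (\<lambda>s. D (inverse s) < e) (at_right 1)"
    using e by (intro order_tendstoD) auto
  have 3: "eventually (\<lambda>s. s > (1::real)) (at_right 1)" by (rule eventually_at_right_less)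
  obtain r where r: "D r < e" "D (inverse r) < e" "r > 1"
    using eventually_happens'[OF _ eventually_conj[OF 1 eventually_conj[OF 2 3]]] by auto
  have "norm (fourier (dilate s P) z) \<le> \<rho> + e" if z: "norm z = 1" and s: "s = r \<or> s = inverse r" for z s
  proof -
    have "fourier (dilate s P) z - fourier P z = (\<Sum>k\<in>F. P k * of_real (s powi k) * z powi k) - (\<Sum>k\<in>F. P k * z powi k)"
      using F by (subst (1 2) fourier_finite_support[OF F(1)]) (auto simp: dilate_def)
    also have "\<dots> = (\<Sum>k\<in>F. P k * of_real (s powi k - 1) * z powi k)"
      by (simp add: sum_subtractf[symmetric] algebra_simps)
    also have "norm \<dots> \<le> D s"
      unfolding D_def
      by (rule sum_norm_le) (simp only: norm_mult norm_of_real norm_powi_unit[OF z] mult_1_right order_refl)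
    finally have "norm (fourier (dilate s P) z - fourier P z) \<le> e" using r s by auto
    then show ?thesis using rho[OF z] norm_triangle_sub[of "fourier (dilate s P) z" "fourier P z"] by simp
  qed
  then show thesis using r that by blast
qed

text \<open>Choose s > 1 with s^j / r < 1. Bernoulli's inequality gives max 1 n \<le> c s^n with c =
  max 1 (1 / (s - 1)), so the weighted sequence is dominated by a convergent geometric one.\<close>

lemma weighted_bounded_exponential:
  assumes p: "p \<ge> 1" and r: "r > 1"
  shows "\<exists>K. weighted_bounded p j (\<lambda>k. of_real (inverse r ^ nat \<bar>k\<bar>)) K"
proof -
  have "((\<lambda>s. s ^ j * inverse r) \<longlongrightarrow> 1 ^ j * inverse r) (at_right 1)"
    by (intro tendsto_intros)
  then have 1: "eventually (\<lambda>s. s ^ j * inverse r < 1) (at_right 1)"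
    using r by (intro order_tendstoD) (auto simp: field_simps)
  obtain s where s: "s ^ j * inverse r < 1" "s > 1"
    using eventually_happens'[OF _ eventually_conj[OF 1 eventually_at_right_less]] by auto
  define c where "c = max 1 (1 / (s - 1))"
  have lin: "max 1 (real n) \<le> c * s ^ n" for n
  proof -
    have "1 + real n * (s - 1) \<le> s ^ n"
      using Bernoulli_inequality[of "s - 1" n] s by simp
    then have "real n \<le> (1 / (s - 1)) * s ^ n" using s by (simp add: field_simps)
    also have "\<dots> \<le> c * s ^ n" using s by (intro mult_right_mono) (auto simp: c_def)
    finally have "real n \<le> c * s ^ n" .
    moreover have "1 * 1 \<le> c * s ^ n" using s by (intro mult_mono) (auto simp: c_def)
    ultimately show ?thesis by simp
  qed
  define g where "g n = c ^ j * (s ^ j * inverse r) ^ n" for n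
  have g: "summable g" unfolding g_def using s r by (intro summable_mult summable_geometric) auto
  have g0: "g n \<ge> 0" for n using s r by (simp add: g_def c_def)
  have "lp_bounded 1 (\<lambda>k. of_real (inverse r ^ nat \<bar>k\<bar>) * of_real (wt j k)) (2 * suminf g)"
    unfolding lp_bounded_1_iff
  proof (intro conjI allI impI)
    show "0 \<le> 2 * suminf g" using suminf_nonneg[OF g g0] by simp
    fix F :: "int set" assume F: "finite F"
    have "norm (complex_of_real (inverse r ^ nat \<bar>k\<bar>) * of_real (wt j k)) \<le> g (nat \<bar>k\<bar>)" for k
    proof -
      have "wt j k = max 1 (real (nat \<bar>k\<bar>)) ^ j" by (simp add: wt_def)
      also have "\<dots> \<le> (c * s ^ nat \<bar>k\<bar>) ^ j" by (intro power_mono lin) auto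
      also have "\<dots> = c ^ j * (s ^ j) ^ nat \<bar>k\<bar>" by (simp add: power_mult_distrib mult.commute flip: power_mult)
      finally have "inverse r ^ nat \<bar>k\<bar> * wt j k \<le> inverse r ^ nat \<bar>k\<bar> * (c ^ j * (s ^ j) ^ nat \<bar>k\<bar>)"
        using r by (intro mult_left_mono) auto
      moreover have "norm (complex_of_real (inverse r ^ nat \<bar>k\<bar>)) = inverse r ^ nat \<bar>k\<bar>"
        using r unfolding norm_of_real by simp
      ultimately show ?thesis unfolding norm_times_wt g_def by (simp add: power_mult_distrib mult_ac)
    qed
    then have "(\<Sum>k\<in>F. norm (complex_of_real (inverse r ^ nat \<bar>k\<bar>) * of_real (wt j k))) \<le> (\<Sum>k\<in>F. g (nat \<bar>k\<bar>))"
      by (intro sum_mono)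
    also have "\<dots> \<le> 2 * suminf g" by (rule sum_nat_abs_le[OF g g0 F])
    finally show "(\<Sum>k\<in>F. norm (complex_of_real (inverse r ^ nat \<bar>k\<bar>) * of_real (wt j k))) \<le> 2 * suminf g" .
  qed
  then show ?thesis unfolding weighted_bounded_def using lp_bounded_1_imp[OF p] by blast
qed

text \<open>Estimating on the circles of radius \<open>r\<close> and \<open>1 / r\<close> gives exponential decay of the coefficients,
  which absorbs every polynomial weight.\<close>

lemma trig_poly_power_bound:
  assumes p: "p \<ge> 1" and F: "finite F" "\<And>n. n \<notin> F \<Longrightarrow> P n = 0" and e: "e > 0"
    and rho: "\<And>z. norm z = 1 \<Longrightarrow> norm (fourier P z) \<le> \<rho>"
  shows "\<exists>K. \<forall>n. weighted_bounded p j (cpow P n) (K * (\<rho> + e) ^ n)"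
proof -
  have rho0: "\<rho> \<ge> 0" using order_trans[OF norm_ge_zero rho[of 1]] by simp
  obtain r where r: "r > 1"
    and dil: "\<And>z s. norm z = 1 \<Longrightarrow> s = r \<or> s = inverse r \<Longrightarrow> norm (fourier (dilate s P) z) \<le> \<rho> + e"
    using dilation_near_1[OF F e rho] by blast
  obtain K where K: "weighted_bounded p j (\<lambda>k. of_real (inverse r ^ nat \<bar>k\<bar>)) K"
    using weighted_bounded_exponential[OF p r] by blast
  have coeff: "norm (cpow P n k) * s powi k \<le> (\<rho> + e) ^ n" if s: "s = r \<or> s = inverse r" for s n k
  proof -
    have s0: "s > 0" using s r by auto
    obtain M where "weighted_bounded 1 0 (dilate s P) M"
      using weighted_bounded_finite_support[of 1 F "dilate s P"] F by (auto simp: dilate_def)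
    then have l: "l1 (dilate s P)" using lp_bounded_1_D by (simp add: weighted_bounded_0)
    have "norm (cpow (dilate s P) n k) \<le> (\<rho> + e) ^ n"
    proof (rule coeff_le_sup[OF l1_cpow[OF l]])
      fix z :: complex assume z: "norm z = 1"
      show "norm (fourier (cpow (dilate s P) n) z) \<le> (\<rho> + e) ^ n"
        using dil[OF z s] by (simp add: fourier_cpow[OF l z] norm_power power_mono)
    qed
    then show ?thesis using s0 by (simp add: dilate_cpow, simp add: dilate_def norm_mult norm_power_int)
  qed
  \<comment> \<open>The circle of radius \<open>r\<close> controls the coefficients with k \<ge> 0,
    the one of radius 1 / r those with k < 0.\<close>
  have decay: "norm (cpow P n k) \<le> (\<rho> + e) ^ n * inverse r ^ nat \<bar>k\<bar>" for n k
  proof (cases "k \<ge> 0")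
    case True
    then show ?thesis using coeff[of r n k] r by (simp add: power_int_def field_simps)
  next
    case False
    then show ?thesis using coeff[of "inverse r" n k] r by (simp add: power_int_def field_simps)
  qed
  have "weighted_bounded p j (cpow P n) (K * (\<rho> + e) ^ n)" for n
  proof -
    have re: "(\<rho> + e) ^ n \<ge> 0" using rho0 e by simp
    have "weighted_bounded p j (\<lambda>k. of_real ((\<rho> + e) ^ n) * of_real (inverse r ^ nat \<bar>k\<bar>)) (norm (complex_of_real ((\<rho> + e) ^ n)) * K)"
      by (rule weighted_bounded_scale[OF p K])
    moreover have "norm (complex_of_real ((\<rho> + e) ^ n)) = (\<rho> + e) ^ n"
      using re unfolding norm_of_real by simp
    ultimately have *: "weighted_bounded p j (\<lambda>k. of_real ((\<rho> + e) ^ n) * of_real (inverse r ^ nat \<bar>k\<bar>)) (K * (\<rho> + e) ^ n)"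
      by (simp only: mult.commute)
    show ?thesis unfolding weighted_bounded_def
    proof (rule lp_bounded_mono[OF p *[unfolded weighted_bounded_def]])
      fix k
      have "norm (complex_of_real ((\<rho> + e) ^ n) * of_real (inverse r ^ nat \<bar>k\<bar>)) = (\<rho> + e) ^ n * inverse r ^ nat \<bar>k\<bar>"
        using re r unfolding of_real_mult[symmetric] norm_of_real by simp
      then show "norm (cpow P n k * of_real (wt j k)) \<le> norm (complex_of_real ((\<rho> + e) ^ n) * of_real (inverse r ^ nat \<bar>k\<bar>) * of_real (wt j k))"
        unfolding norm_times_wt using decay[of n k] wt_ge_1[of j k] by (simp only: mult_right_mono)
    qed simp
  qed
  then show ?thesis by blast
qed

section \<open>Neumann series and inversion\<close>

context weighted_lp
begin

text \<open>Summable bounds on the powers make the series converge in the weighted space; the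
  embedding into l^1 passes the tail estimate to each point of the circle, where the series is
  geometric.\<close>

lemma neumann_series:
  assumes f: "weighted_bounded p j f M" and B: "\<And>n. weighted_bounded p j (cpow f n) (B n)" and sB: "summable B"
  shows "\<exists>h N. weighted_bounded p j h N \<and> (\<forall>z. norm z = 1 \<longrightarrow> fourier h z * (1 - fourier f z) = 1)"
proof -
  define h where "h = (\<lambda>n. \<Sum>i. cpow f i n)"
  have h: "weighted_bounded p j h (suminf B)" unfolding h_def by (rule weighted_bounded_suminf[OF p B sB])
  have "fourier h z * (1 - fourier f z) = 1" if z: "norm z = 1" for z
  proof -
    define x where "x = fourier f z"
    have part: "l1 (\<lambda>n. \<Sum>i<m. cpow f i n) \<and> fourier (\<lambda>n. \<Sum>i<m. cpow f i n) z = (\<Sum>i<m. x ^ i)" for m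
    proof (induction m)
      case 0
      then show ?case by (simp add: fourier_def)
    next
      case (Suc m)
      then show ?case using l1_cpow[OF weighted_bounded_l1[OF f]] fourier_cpow[OF weighted_bounded_l1[OF f] z] z
        by (simp add: fourier_add l1_add x_def)
    qed
    have tail: "norm ((\<Sum>i<m. x ^ i) - fourier h z) \<le> K * (\<Sum>i. B (i + m))" for m
    proof -
      have sBm: "summable (\<lambda>i. B (i + m))" using sB by (simp add: summable_iff_shift)
      have "weighted_bounded p j (\<lambda>n. \<Sum>i. cpow f (i + m) n) (\<Sum>i. B (i + m))"
        by (rule weighted_bounded_suminf(2)[OF p B sBm])
      moreover have "(\<lambda>n. \<Sum>i. cpow f (i + m) n) = (\<lambda>n. h n - (\<Sum>i<m. cpow f i n))"
        unfolding h_def using suminf_minus_initial_segment[OF weighted_bounded_suminf(1)[OF p B sB]] by auto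
      ultimately have "norm (fourier (\<lambda>n. h n - (\<Sum>i<m. cpow f i n)) z) \<le> K * (\<Sum>i. B (i + m))"
        using fourier_norm_le[OF weighted_bounded_l1_bound z] by simp
      moreover have "fourier (\<lambda>n. h n - (\<Sum>i<m. cpow f i n)) z = fourier h z - (\<Sum>i<m. x ^ i)"
        using part[of m] by (simp add: fourier_diff[OF weighted_bounded_l1[OF h] _ z])
      ultimately show ?thesis by (simp add: norm_minus_commute)
    qed
    have "(\<lambda>m. K * (\<Sum>i. B (i + m))) \<longlonglongrightarrow> K * 0"
      by (intro tendsto_intros suminf_exist_split2 sB)
    then have "(\<lambda>m. (\<Sum>i<m. x ^ i) - fourier h z) \<longlonglongrightarrow> 0"
      by (intro Lim_null_comparison[OF always_eventually[OF allI[OF tail]]]) simp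
    then have s: "(\<lambda>i. x ^ i) sums fourier h z" unfolding sums_def by (rule LIM_zero_cancel)
    \<comment> \<open>Convergence of the geometric series by itself yields |x| < 1.\<close>
    then have "norm x < 1" using sums_summable summable_geometric_iff by blast
    then have "fourier h z = 1 / (1 - x)" "x \<noteq> 1" using sums_unique2[OF s geometric_sums] by auto
    then show ?thesis by (simp add: x_def)
  qed
  then show ?thesis using h by blast
qed

text \<open>The weighted norm of \<open>f\<close> may be large, but its powers decay: write f = P +
  g with \<open>P\<close> finitely supported and \<open>g\<close> of small weighted norm. The powers
  of \<open>P\<close> grow almost at the rate of its sup norm on the circle, and each factor
  \<open>g\<close> costs at most \<open>C * \<eta>\<close>.\<close>

lemma neumann_sup_norm:
  assumes f: "weighted_bounded p j f M" and \<rho>: "\<And>z. norm z = 1 \<Longrightarrow> norm (fourier f z) \<le> \<rho>" and "\<rho> < 1"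
  shows "\<exists>h N. weighted_bounded p j h N \<and> (\<forall>z. norm z = 1 \<longrightarrow> fourier h z * (1 - fourier f z) = 1)"
proof -
  \<comment> \<open>The three terms of the denominator are the losses to be kept below 1 - \<rho>:
    \<open>K * \<eta>\<close> in passing from \<open>f\<close> to \<open>P\<close> in sup norm,
    \<eta> as the slack in the power bound for \<open>P\<close>, and \<open>C * \<eta>\<close> for a
    convolution with \<open>g\<close>.\<close>
  define \<eta> where "\<eta> = (1 - \<rho>) / 2 / (K + 1 + C)"
  have KC: "K + 1 + C > 0" using K_pos C_pos by simp
  have \<eta>: "\<eta> > 0" using KC \<open>\<rho> < 1\<close> by (simp add: \<eta>_def)
  have "\<eta> * (K + 1 + C) = (1 - \<rho>) / 2"
    using nonzero_eq_divide_eq[of "K + 1 + C" \<eta> "(1 - \<rho>) / 2"] KC \<eta>_def by linarith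
  then have sum: "\<rho> + K * \<eta> + \<eta> + C * \<eta> < 1" using \<open>\<rho> < 1\<close> by (simp add: algebra_simps)
  have rho0: "\<rho> \<ge> 0" using order_trans[OF norm_ge_zero \<rho>[of 1]] by simp
  obtain F where F: "finite F" "weighted_bounded p j (\<lambda>n. f n - trunc F f n) \<eta>"
    using weighted_bounded_trunc_small[OF p f \<eta>] by blast
  define P g where "P = trunc F f" and "g = (\<lambda>n. f n - trunc F f n)"
  note lf = weighted_bounded_l1[OF f]
  have lP: "l1 P" unfolding P_def by (rule l1_trunc[OF lf])
  have g: "weighted_bounded p j g \<eta>" using F by (simp add: g_def)
  note lg = weighted_bounded_l1[OF g]
  have evg: "fourier g z = fourier f z - fourier P z" if "norm z = 1" for z
    unfolding g_def P_def[symmetric] using that by (simp add: fourier_diff lf lP)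
  have "norm (fourier P z) \<le> \<rho> + K * \<eta>" if z: "norm z = 1" for z
    using fourier_norm_le[OF weighted_bounded_l1_bound[OF g] z] \<rho>[OF z] norm_triangle_ineq4[of "fourier f z" "fourier g z"]
    by (simp add: evg[OF z])
  then obtain KP where KP: "\<And>n. weighted_bounded p j (cpow P n) (KP * (\<rho> + K * \<eta> + \<eta>) ^ n)"
    using trig_poly_power_bound[OF p F(1), of P \<eta> "\<rho> + K * \<eta>" j] \<eta> by (auto simp: P_def trunc_def)
  define \<sigma> \<tau> where "\<sigma> = \<rho> + K * \<eta> + \<eta>" and "\<tau> = \<sigma> + C * \<eta>"
  have \<tau>: "0 \<le> \<tau>" "\<tau> < 1" using sum rho0 K_pos C_pos \<eta> by (auto simp: \<sigma>_def \<tau>_def)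
  \<comment> \<open>The mixed products \<open>P\<^sup>m f\<^sup>n\<close> stand in for the binomial expansion of \<open>(P + g)\<^sup>n\<close>.\<close>
  have "weighted_bounded p j (conv (cpow P m) (cpow f n)) (KP * \<sigma> ^ m * \<tau> ^ n)" for m n
  proof (induction n arbitrary: m)
    case 0
    have "conv (cpow P m) (cpow f 0) = cpow P m"
      by (rule fourier_inj) (auto simp: l1_conv l1_cpow lP l1_delta fourier_conv fourier_delta)
    then show ?case using KP[of m] by (simp add: \<sigma>_def)
  next
    case (Suc n)
    have eq: "conv (cpow P m) (cpow f (Suc n)) =
      (\<lambda>i. conv (cpow P (Suc m)) (cpow f n) i + conv g (conv (cpow P m) (cpow f n)) i)"
      by (rule fourier_inj)
        (auto simp: l1_conv l1_cpow l1_add lP lf lg fourier_conv fourier_add fourier_cpow evg algebra_simps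
           simp del: cpow.simps)
    have "weighted_bounded p j (conv (cpow P m) (cpow f (Suc n)))
       (KP * \<sigma> ^ Suc m * \<tau> ^ n + C * \<eta> * (KP * \<sigma> ^ m * \<tau> ^ n))"
      unfolding eq by (intro weighted_bounded_add p weighted_bounded_conv g Suc.IH)
    then show ?case by (simp add: \<tau>_def algebra_simps)
  qed
  from this[of 0] have "weighted_bounded p j (cpow f n) (KP * \<tau> ^ n)" for n
  proof -
    have "conv (cpow P 0) (cpow f n) = cpow f n"
      by (rule fourier_inj) (auto simp: l1_conv l1_cpow lf l1_delta fourier_conv fourier_delta)
    then show ?thesis using \<open>\<And>n. weighted_bounded p j (conv (cpow P 0) (cpow f n)) (KP * \<sigma> ^ 0 * \<tau> ^ n)\<close>[of n] by simp
  qed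
  then show ?thesis
    by (rule neumann_series[OF f]) (use \<tau> in \<open>auto intro!: summable_mult summable_geometric\<close>)
qed

text \<open>With m > 0 the minimum and R the maximum of the squared modulus on the compact circle,
  \<open>f\<close> takes values in [0, 1 - m / R]. The Neumann series inverts 1 - f, which is the
  squared modulus divided by R, and multiplying that inverse by the conjugate over R inverts the
  Fourier series of \<open>v\<close>.\<close>

theorem wiener_inverse:
  assumes v: "weighted_bounded p j v M" and nz: "\<And>z. norm z = 1 \<Longrightarrow> fourier v z \<noteq> 0"
  shows "\<exists>w N. weighted_bounded p j w N \<and> (\<forall>z. norm z = 1 \<longrightarrow> fourier v z * fourier w z = 1)"
proof -
  note lv = weighted_bounded_l1[OF v]
  note sv = weighted_bounded_star[OF p v]
  note lsv = weighted_bounded_l1[OF sv]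
  have cont: "continuous_on (sphere 0 1) (\<lambda>z. norm (fourier v z))"
    by (intro continuous_intros fourier_continuous lv)
  have cpt: "compact (sphere (0::complex) 1)" and ne: "sphere (0::complex) 1 \<noteq> {}"
    by (auto simp: sphere_eq_empty)
  obtain z0 where z0: "norm z0 = 1" "\<And>z. norm z = 1 \<Longrightarrow> norm (fourier v z0) \<le> norm (fourier v z)"
    using continuous_attains_inf[OF cpt ne cont] by (auto simp: dist_norm)
  obtain z1 where z1: "norm z1 = 1" "\<And>z. norm z = 1 \<Longrightarrow> norm (fourier v z) \<le> norm (fourier v z1)"
    using continuous_attains_sup[OF cpt ne cont] by (auto simp: dist_norm)
  define m R where "m = norm (fourier v z0) ^ 2" and "R = norm (fourier v z1) ^ 2"
  have mR: "m > 0" "R > 0" using nz z0 z1 by (auto simp: m_def R_def)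
  obtain Md where d: "weighted_bounded p j (delta 0) Md" using weighted_bounded_delta[OF p] by blast
  define q where "q = conv v (star v)"
  have q: "weighted_bounded p j q (C * M * M)" unfolding q_def by (rule weighted_bounded_conv[OF v sv])
  have evq: "fourier q z = of_real (norm (fourier v z) ^ 2)" if z: "norm z = 1" for z
    unfolding complex_norm_square by (simp add: q_def fourier_conv[OF lv lsv z] fourier_star[OF z])
  define f where "f = (\<lambda>n. delta 0 n - of_real (1 / R) * q n)"
  obtain Mf where f: "weighted_bounded p j f Mf"
    using weighted_bounded_diff[OF p d weighted_bounded_scale[OF p q, of "of_real (1 / R)"]] unfolding f_def by blast
  have evf: "fourier f z = of_real (1 - norm (fourier v z) ^ 2 / R)" if z: "norm z = 1" for z
    unfolding f_def fourier_diff[OF l1_delta l1_scale[OF weighted_bounded_l1[OF q]] z] fourier_scale evq[OF z] fourier_delta by simp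
  have "norm (fourier f z) \<le> 1 - m / R" if z: "norm z = 1" for z
  proof -
    have "m \<le> norm (fourier v z) ^ 2" "norm (fourier v z) ^ 2 \<le> R"
      using z0(2)[OF z] z1(2)[OF z] by (auto simp: m_def R_def intro: power_mono)
    then have "norm (fourier v z) ^ 2 / R \<le> 1" "m / R \<le> norm (fourier v z) ^ 2 / R"
      using mR by (auto simp: divide_le_eq intro: divide_right_mono)
    then show ?thesis unfolding evf[OF z] norm_of_real by simp
  qed
  moreover have "1 - m / R < 1" using mR by simp
  ultimately obtain h N where h: "weighted_bounded p j h N" "\<And>z. norm z = 1 \<Longrightarrow> fourier h z * (1 - fourier f z) = 1"
    using neumann_sup_norm[OF f] by blast
  define w where "w = (\<lambda>n. of_real (1 / R) * conv (star v) h n)"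
  have w: "weighted_bounded p j w (norm (complex_of_real (1 / R)) * (C * M * N))"
    unfolding w_def by (intro weighted_bounded_scale p weighted_bounded_conv sv h)
  have "fourier v z * fourier w z = 1" if z: "norm z = 1" for z
  proof -
    have "fourier v z * fourier w z = fourier v z * cnj (fourier v z) / of_real R * fourier h z"
      unfolding w_def fourier_scale fourier_conv[OF lsv weighted_bounded_l1[OF h(1)] z] fourier_star[OF z] by simp
    also have "\<dots> = fourier h z * (1 - fourier f z)"
      unfolding evf[OF z] of_real_diff of_real_divide complex_norm_square by simp
    finally show ?thesis using h(2)[OF z] by simp
  qed
  then show ?thesis using w by blast
qed

end

section \<open>Characters and automatic continuity\<close>

lemma linear_on_seqD:
  assumes "linear_on_seq S T" "f \<in> S"
  shows "g \<in> S \<Longrightarrow> T (\<lambda>n. f n + g n) = (\<lambda>n. T f n + T g n)" "T (\<lambda>n. c * f n) = (\<lambda>n. c * T f n)"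
  using assms by (simp_all add: linear_on_seq_def)

context weighted_lp
begin

definition A :: "(int \<Rightarrow> complex) set" where
  "A = {f. \<exists>M. weighted_bounded p j f M}"

lemma A_I: "weighted_bounded p j f M \<Longrightarrow> f \<in> A"
  by (auto simp: A_def)

lemma A_l1: "f \<in> A \<Longrightarrow> l1 f"
  by (auto simp: A_def intro: weighted_bounded_l1)

lemma A_add: "f \<in> A \<Longrightarrow> g \<in> A \<Longrightarrow> (\<lambda>n. f n + g n) \<in> A"
  by (auto simp: A_def intro: weighted_bounded_add[OF p])

lemma A_diff: "f \<in> A \<Longrightarrow> g \<in> A \<Longrightarrow> (\<lambda>n. f n - g n) \<in> A"
  by (auto simp: A_def intro: weighted_bounded_diff[OF p])

lemma A_scale: "f \<in> A \<Longrightarrow> (\<lambda>n. c * f n) \<in> A"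
  by (auto simp: A_def intro: weighted_bounded_scale[OF p])

lemma A_conv: "f \<in> A \<Longrightarrow> g \<in> A \<Longrightarrow> conv f g \<in> A"
  by (auto simp: A_def intro: weighted_bounded_conv)

lemma A_star: "f \<in> A \<Longrightarrow> star f \<in> A"
  by (auto simp: A_def intro: weighted_bounded_star[OF p])

lemma A_delta: "delta k \<in> A"
  using weighted_bounded_delta[OF p] by (auto simp: A_def)

lemma A_finite_support: "finite F \<Longrightarrow> (\<And>n. n \<notin> F \<Longrightarrow> f n = 0) \<Longrightarrow> f \<in> A"
  using weighted_bounded_finite_support[OF p] by (auto simp: A_def)

text \<open>The hypotheses on \<theta> are purely algebraic, so the result applies to evaluation
  after \<open>T\<close> while the continuity of \<open>T\<close> is still open; the coordinate
  bounds behind that continuity depend on it. The point of the circle is the value of \<theta> at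
  \<open>delta 1\<close>, the sequence with Fourier series z.\<close>

theorem character_eq_fourier:
  fixes \<theta> :: "(int \<Rightarrow> complex) \<Rightarrow> complex"
  assumes add: "\<And>f g. f \<in> A \<Longrightarrow> g \<in> A \<Longrightarrow> \<theta> (\<lambda>n. f n + g n) = \<theta> f + \<theta> g"
    and scale: "\<And>c f. f \<in> A \<Longrightarrow> \<theta> (\<lambda>n. c * f n) = c * \<theta> f"
    and mult: "\<And>f g. f \<in> A \<Longrightarrow> g \<in> A \<Longrightarrow> \<theta> (conv f g) = \<theta> f * \<theta> g"
    and one: "\<theta> (delta 0) = 1"
    and f: "f \<in> A"
  shows "norm (\<theta> (delta 1)) = 1 \<and> \<theta> f = fourier f (\<theta> (delta 1))"
proof -
  have diff: "\<theta> (\<lambda>n. g n - c * delta 0 n) = \<theta> g - c" if "g \<in> A" for g c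
    using add[OF that A_scale[OF A_delta], of "- c" 0] scale[OF A_delta, of "- c" 0] one by simp
  \<comment> \<open>The Fourier series of \<open>q\<close> is \<open>|a|\<^sup>2 + |g|\<^sup>2\<close> with \<open>a\<close>, \<open>g\<close> in the kernel, so \<open>q\<close> is not invertible
    and by Wiener's lemma \<open>a\<close> and \<open>g\<close> have a common zero on the circle.\<close>
  define a where "a = (\<lambda>n. delta 1 n - \<theta> (delta 1) * delta 0 n)"
  define g where "g = (\<lambda>n. f n - \<theta> f * delta 0 n)"
  define q where "q = (\<lambda>n. conv a (star a) n + conv g (star g) n)"
  have aA: "a \<in> A" unfolding a_def by (intro A_diff A_scale A_delta)
  have gA: "g \<in> A" unfolding g_def by (intro A_diff A_scale A_delta f)
  have qA: "q \<in> A" unfolding q_def by (intro A_add A_conv A_star aA gA)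
  have "\<theta> a = 0" unfolding a_def by (simp add: diff A_delta)
  moreover have "\<theta> g = 0" unfolding g_def by (simp add: diff f)
  ultimately have \<theta>q: "\<theta> q = 0" unfolding q_def by (simp add: add A_conv A_star aA gA mult)
  have "\<exists>z. norm z = 1 \<and> fourier q z = 0"
  proof (rule ccontr)
    assume "\<not> (\<exists>z. norm z = 1 \<and> fourier q z = 0)"
    then obtain w N where w: "weighted_bounded p j w N" "\<And>z. norm z = 1 \<Longrightarrow> fourier q z * fourier w z = 1"
      using wiener_inverse qA unfolding A_def by blast
    have wA: "w \<in> A" using w(1) by (rule A_I)
    have "conv q w = delta 0"
      by (rule fourier_inj) (simp_all add: l1_conv A_l1 qA wA l1_delta fourier_conv fourier_delta w(2))
    then show False using mult[OF qA wA] one \<theta>q by simp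
  qed
  then obtain z where z: "norm z = 1" "fourier q z = 0" by blast
  have "fourier q z = of_real (norm (fourier a z) ^ 2) + of_real (norm (fourier g z) ^ 2)"
    unfolding q_def complex_norm_square
    using z(1) by (simp add: fourier_add fourier_conv fourier_star l1_conv A_l1 aA gA A_star)
  then have "norm (fourier a z) ^ 2 + norm (fourier g z) ^ 2 = 0"
    using z(2) unfolding of_real_add[symmetric] by (metis of_real_eq_0_iff)
  then have "fourier a z = 0" "fourier g z = 0" by (simp_all add: add_nonneg_eq_0_iff)
  moreover have "fourier a z = z - \<theta> (delta 1)" "fourier g z = fourier f z - \<theta> f"
    unfolding a_def g_def using z(1) by (simp_all add: fourier_diff fourier_scale l1_scale l1_delta fourier_delta A_l1 f)
  ultimately show ?thesis using z(1) by auto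
qed

section \<open>Completeness and the Baire argument\<close>

definition nrm :: "(int \<Rightarrow> complex) \<Rightarrow> real" where
  "nrm f = lp_norm p (\<lambda>n. f n * of_real (wt j n))"

lemma nrm_le: "weighted_bounded p j f M \<Longrightarrow> nrm f \<le> M"
  unfolding nrm_def weighted_bounded_def by (rule lp_norm_le[OF p])

lemma weighted_bounded_nrm: "f \<in> A \<Longrightarrow> weighted_bounded p j f (nrm f)"
  unfolding nrm_def weighted_bounded_def A_def using lp_bounded_lp_norm[OF p] lp_space_iff_bounded[OF p] by blast

lemma weighted_bounded_coord: "weighted_bounded p j f M \<Longrightarrow> norm (f n) \<le> M"
  using lp_bounded_coord[OF p weighted_bounded_lp_bounded[OF p]] by blast

interpretation Metric_space A "\<lambda>f g. nrm (\<lambda>n. f n - g n)"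
proof
  show "0 \<le> nrm (\<lambda>n. f n - g n)" for f g by (simp add: nrm_def lp_norm_def)
  show "nrm (\<lambda>n. f n - g n) = nrm (\<lambda>n. g n - f n)" for f g
    unfolding nrm_def lp_norm_def norm_times_wt by (simp only: norm_minus_commute)
  show "(nrm (\<lambda>n. f n - g n) = 0) = (f = g)" if "f \<in> A" "g \<in> A" for f g
  proof
    assume "nrm (\<lambda>n. f n - g n) = 0"
    then have "norm (f n - g n) \<le> 0" for n
      using weighted_bounded_coord[OF weighted_bounded_nrm[OF A_diff[OF that]], of n] by simp
    then show "f = g" by auto
  qed (simp add: nrm_def lp_norm_def)
  show "nrm (\<lambda>n. f n - h n) \<le> nrm (\<lambda>n. f n - g n) + nrm (\<lambda>n. g n - h n)"
    if "f \<in> A" "g \<in> A" "h \<in> A" for f g h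
    using nrm_le[OF weighted_bounded_add[OF p weighted_bounded_nrm[OF A_diff[OF that(1,2)]] weighted_bounded_nrm[OF A_diff[OF that(2,3)]]]] by simp
qed

text \<open>Coordinates are Cauchy, hence converge. Letting the second index tend to infinity in the
  Cauchy estimate, the pointwise limit keeps the bound; this gives both norm convergence and
  membership of the limit in \<open>A\<close>.\<close>

lemma mcomplete_A: "mcomplete"
  unfolding mcomplete_def
proof (intro allI impI)
  fix \<sigma> assume c: "MCauchy \<sigma>"
  then have \<sigma>: "\<sigma> i \<in> A" for i by (auto simp: MCauchy_def)
  have small: "\<exists>N. \<forall>i\<ge>N. \<forall>k\<ge>N. weighted_bounded p j (\<lambda>n. \<sigma> i n - \<sigma> k n) e" if e: "e > 0" for e
  proof -
    obtain N where "\<And>i k. i \<ge> N \<Longrightarrow> k \<ge> N \<Longrightarrow> nrm (\<lambda>n. \<sigma> i n - \<sigma> k n) < e"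
      using c e unfolding MCauchy_def by blast
    then show ?thesis
      using weighted_bounded_mono[OF p weighted_bounded_nrm[OF A_diff[OF \<sigma> \<sigma>]] order_refl] by (meson less_imp_le)
  qed
  have "Cauchy (\<lambda>i. \<sigma> i n)" for n
  proof (rule CauchyI)
    fix e :: real assume "e > 0"
    then obtain N where "\<forall>i\<ge>N. \<forall>k\<ge>N. weighted_bounded p j (\<lambda>n. \<sigma> i n - \<sigma> k n) (e / 2)"
      using small[of "e / 2"] by auto
    then have "\<forall>i\<ge>N. \<forall>k\<ge>N. norm (\<sigma> i n - \<sigma> k n) \<le> e / 2" using weighted_bounded_coord by blast
    then show "\<exists>N. \<forall>i\<ge>N. \<forall>k\<ge>N. norm (\<sigma> i n - \<sigma> k n) < e"
      using \<open>e > 0\<close> by (intro exI[of _ N]) force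
  qed
  then have "\<forall>n. \<exists>l. (\<lambda>i. \<sigma> i n) \<longlonglongrightarrow> l" using Cauchy_convergent convergent_def by blast
  then obtain l where l: "\<And>n. (\<lambda>i. \<sigma> i n) \<longlonglongrightarrow> l n" by metis
  have lim: "\<exists>N. \<forall>i\<ge>N. weighted_bounded p j (\<lambda>n. \<sigma> i n - l n) e" if e: "e > 0" for e
  proof -
    obtain N where N: "\<forall>i\<ge>N. \<forall>k\<ge>N. weighted_bounded p j (\<lambda>n. \<sigma> i n - \<sigma> k n) e" using small[OF e] by blast
    have "weighted_bounded p j (\<lambda>n. \<sigma> i n - l n) e" if "i \<ge> N" for i
    proof (rule weighted_bounded_tendsto[OF p sequentially_bot])
      show "(\<lambda>k. \<sigma> i n - \<sigma> k n) \<longlonglongrightarrow> \<sigma> i n - l n" for n by (intro tendsto_intros l)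
      show "\<forall>\<^sub>F k in sequentially. weighted_bounded p j (\<lambda>n. \<sigma> i n - \<sigma> k n) e"
        using N that by (auto simp: eventually_sequentially)
    qed
    then show ?thesis by blast
  qed
  obtain N where "weighted_bounded p j (\<lambda>n. \<sigma> N n - l n) 1" using lim[of 1] by auto
  from A_diff[OF \<sigma>[of N] A_I[OF this]] have lA: "l \<in> A" by simp
  have "limitin mtopology \<sigma> l sequentially"
    unfolding limit_metric_sequentially
  proof (intro conjI allI impI lA)
    fix e :: real assume e: "e > 0"
    then obtain N where N: "\<forall>i\<ge>N. weighted_bounded p j (\<lambda>n. \<sigma> i n - l n) (e / 2)" using lim[of "e / 2"] by auto
    have "\<sigma> i \<in> A \<and> nrm (\<lambda>n. \<sigma> i n - l n) < e" if "i \<ge> N" for i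
      using nrm_le[of _ "e / 2"] N that e \<sigma>[of i] by fastforce
    then show "\<exists>N. \<forall>i\<ge>N. \<sigma> i \<in> A \<and> nrm (\<lambda>n. \<sigma> i n - l n) < e" by blast
  qed
  then show "\<exists>x. limitin mtopology \<sigma> x sequentially" by blast
qed

lemma linear_on_seq_diff:
  assumes "linear_on_seq A T" "f \<in> A" "g \<in> A"
  shows "T (\<lambda>n. f n - g n) = (\<lambda>n. T f n - T g n)"
proof -
  have "T (\<lambda>n. f n + (- 1) * g n) = (\<lambda>n. T f n + T (\<lambda>n. (- 1) * g n) n)"
    by (rule linear_on_seqD(1)[OF assms(1,2) A_scale[OF assms(3)]])
  also have "T (\<lambda>n. (- 1) * g n) = (\<lambda>n. (- 1) * T g n)"
    by (rule linear_on_seqD(2)[OF assms(1,3)])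
  finally show ?thesis by simp
qed

text \<open>A closed graph argument: coordinate bounds turn norm convergence of arguments into
  pointwise convergence of images, so each set \<open>E m\<close> is closed. These sets cover
  \<open>A\<close>; by Baire one of them contains a ball, and linearity rescales the bound to all of
  \<open>A\<close>.\<close>

theorem bounded_if_coordinates_bounded:
  assumes lin: "linear_on_seq A T" and TA: "\<And>f. f \<in> A \<Longrightarrow> T f \<in> A"
    and coord: "\<And>f M n. weighted_bounded p j f M \<Longrightarrow> norm (T f n) \<le> L * M"
  shows "\<exists>B. \<forall>f M. weighted_bounded p j f M \<longrightarrow> weighted_bounded p j (T f) (B * M)"
proof -
  define E where "E m = {f \<in> A. weighted_bounded p j (T f) (real m)}" for m :: nat
  have closed: "closedin mtopology (E m)" for m
    unfolding metric_closedin_iff_sequentially_closed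
  proof (intro conjI allI impI)
    show "E m \<subseteq> A" by (auto simp: E_def)
    fix \<sigma> l assume *: "range \<sigma> \<subseteq> E m \<and> limitin mtopology \<sigma> l sequentially"
    then have \<sigma>: "\<sigma> i \<in> A" "weighted_bounded p j (T (\<sigma> i)) (real m)" for i by (auto simp: E_def)
    have lA: "l \<in> A" using * by (auto simp: limit_metric_sequentially)
    have null: "(\<lambda>i. nrm (\<lambda>n. \<sigma> i n - l n)) \<longlonglongrightarrow> 0"
    proof (rule LIMSEQ_I)
      fix e :: real assume "e > 0"
      then obtain N where "\<forall>i\<ge>N. nrm (\<lambda>n. \<sigma> i n - l n) < e"
        using * unfolding limit_metric_sequentially by blast
      then show "\<exists>N. \<forall>i\<ge>N. norm (nrm (\<lambda>n. \<sigma> i n - l n) - 0) < e" by auto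
    qed
    have "weighted_bounded p j (T l) (real m)"
    proof (rule weighted_bounded_tendsto[OF p sequentially_bot])
      show "\<forall>\<^sub>F i in sequentially. weighted_bounded p j (T (\<sigma> i)) (real m)" using \<sigma> by simp
      fix n
      have "norm (T (\<sigma> i) n - T l n) \<le> L * nrm (\<lambda>n. \<sigma> i n - l n)" for i
        using coord[OF weighted_bounded_nrm[OF A_diff[OF \<sigma>(1)[of i] lA]], of n]
        by (simp add: linear_on_seq_diff[OF lin \<sigma>(1) lA])
      moreover have "(\<lambda>i. L * nrm (\<lambda>n. \<sigma> i n - l n)) \<longlonglongrightarrow> 0"
        using tendsto_mult_right_zero[OF null] by simp
      ultimately have "(\<lambda>i. T (\<sigma> i) n - T l n) \<longlonglongrightarrow> 0"
        by (rule Lim_null_comparison[OF always_eventually[OF allI]])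
      then show "(\<lambda>i. T (\<sigma> i) n) \<longlonglongrightarrow> T l n" by (rule LIM_zero_cancel)
    qed
    then show "l \<in> E m" using lA by (simp add: E_def)
  qed
  have union: "\<Union>(range E) = A"
  proof
    show "A \<subseteq> \<Union>(range E)"
    proof
      fix f assume f: "f \<in> A"
      obtain m :: nat where "nrm (T f) \<le> real m" using real_arch_simple by blast
      then have "f \<in> E m"
        using f weighted_bounded_mono[OF p weighted_bounded_nrm[OF TA[OF f]] order_refl] by (auto simp: E_def)
      then show "f \<in> \<Union>(range E)" by blast
    qed
  qed (auto simp: E_def)
  have "mtopology interior_of A \<noteq> {}"
    using A_delta[of 0] interior_of_topspace[of mtopology] by auto
  have "\<exists>m. mtopology interior_of (E m) \<noteq> {}"
  proof (rule ccontr)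
    assume "\<not> ?thesis"
    then have "mtopology interior_of \<Union>(range E) = {}"
      by (intro metric_Baire_category_alt[OF mcomplete_A]) (auto intro: closed)
    then show False using \<open>mtopology interior_of A \<noteq> {}\<close> by (simp only: union)
  qed
  then obtain m x r where x: "x \<in> A" and r: "r > 0" "mball x r \<subseteq> E m"
    unfolding ex_in_conv[symmetric] in_interior_of_mball by blast
  have xE: "weighted_bounded p j (T x) (real m)" using r x by (auto simp: E_def subset_eq)
  have "weighted_bounded p j (T f) (4 * real m / r * M)" if f: "weighted_bounded p j f M" for f M
  proof (cases "M = 0")
    case True
    then have "f = (\<lambda>n. 0 * f n)" using weighted_bounded_coord[OF f] by auto
    then have "T f = (\<lambda>n. 0 * T f n)" using linear_on_seqD(2)[OF lin A_I[OF f], of 0] by simp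
    then have "T f = (\<lambda>n. 0)" by auto
    then show ?thesis using True by (simp add: weighted_bounded_def lp_bounded_zero)
  next
    case False
    then have M: "M > 0" using weighted_bounded_nonneg[OF f] by simp
    note fA = A_I[OF f]
    \<comment> \<open>Scaling by \<open>c\<close> brings \<open>f\<close> to norm at most r / 2, so
      x - g lies in the ball. As T x and T (x - g) are both bounded by m, T g is bounded by 2 m, and
      dividing by \<open>c\<close> yields 4 m / r times M.\<close>
    define c where "c = r / (2 * M)"
    have c: "c > 0" using M r by (simp add: c_def)
    define g where "g = (\<lambda>n. of_real c * f n)"
    have gA: "g \<in> A" unfolding g_def by (rule A_scale[OF fA])
    have "nrm g \<le> norm (complex_of_real c) * M"
      unfolding g_def by (rule nrm_le[OF weighted_bounded_scale[OF p f]])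
    also have "\<dots> = r / 2" using M r by (simp add: c_def norm_divide norm_mult)
    finally have "nrm g < r" using r by simp
    have xg: "(\<lambda>n. x n - g n) \<in> A" by (rule A_diff[OF x gA])
    then have "(\<lambda>n. x n - g n) \<in> mball x r" using \<open>nrm g < r\<close> x by simp
    then have "(\<lambda>n. x n - g n) \<in> E m" using r by blast
    then have "weighted_bounded p j (T (\<lambda>n. x n - g n)) (real m)" by (simp add: E_def)
    from weighted_bounded_diff[OF p xE this] have "weighted_bounded p j (T g) (2 * real m)"
      using linear_on_seq_diff[OF lin x gA] by simp
    moreover have "T g = (\<lambda>n. of_real c * T f n)"
      unfolding g_def by (rule linear_on_seqD(2)[OF lin fA])
    ultimately have "weighted_bounded p j (\<lambda>n. of_real (1 / c) * (of_real c * T f n)) (norm (complex_of_real (1 / c)) * (2 * real m))"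
      using weighted_bounded_scale[OF p, of j "T g" "2 * real m" "of_real (1 / c)"] by simp
    moreover have "(\<lambda>n. of_real (1 / c) * (of_real c * T f n)) = T f" using c by auto
    moreover have "norm (complex_of_real (1 / c)) * (2 * real m) = 4 * real m / r * M"
      using c M r unfolding norm_of_real by (simp add: c_def)
    ultimately show ?thesis by simp
  qed
  then show ?thesis by blast
qed

end

section \<open>Automorphisms\<close>

lemma weighted_bounded_deriv_seq:
  assumes "p \<ge> 1" "weighted_bounded p (Suc i) f M" shows "weighted_bounded p i (deriv_seq f) M"
  unfolding weighted_bounded_def
proof (rule lp_bounded_mono[OF assms(1) assms(2)[unfolded weighted_bounded_def]])
  fix n
  have "norm (f n) * (\<bar>of_int n\<bar> * wt i n) \<le> norm (f n) * wt (Suc i) n"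
    using wt_ge_1[of i n] by (intro mult_left_mono) (auto simp: wt_def intro!: mult_right_mono)
  then show "norm (deriv_seq f n * of_real (wt i n)) \<le> norm (f n * of_real (wt (Suc i) n))"
    unfolding norm_times_wt by (simp add: deriv_seq_def norm_mult mult_ac)
qed simp

lemma norm_powi_diff_le:
  fixes z w :: complex
  assumes "norm z = 1" "norm w = 1"
  shows "norm (z powi n - w powi n) \<le> \<bar>of_int n\<bar> * norm (z - w)"
proof (cases "n \<ge> 0")
  case True
  then show ?thesis using norm_power_diff[of z w "nat n"] assms by (simp add: power_int_def)
next
  case False
  have "z \<noteq> 0" "w \<noteq> 0" using assms by auto
  then have "norm (inverse z - inverse w) = norm (z - w)"
    using assms by (simp add: inverse_diff_inverse norm_mult norm_inverse norm_minus_commute)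
  then show ?thesis
    using False norm_power_diff[of "inverse z" "inverse w" "nat (- n)"] assms
    by (simp add: power_int_def norm_inverse)
qed

lemma unit_circle_cis: "norm z = 1 \<Longrightarrow> \<exists>t. z = cis t"
  using rcis_cmod_Arg[of z] by (intro exI[of _ "Arg z"]) (simp add: rcis_def)

lemma fourier_lipschitz:
  assumes f: "l1 f" and Df: "lp_bounded 1 (deriv_seq f) L" and z: "norm z = 1" and w: "norm w = 1"
  shows "norm (fourier f z - fourier f w) \<le> L * norm (z - w)"
proof -
  have le: "norm (f n * z powi n - f n * w powi n) \<le> norm (deriv_seq f n) * norm (z - w)" for n
    using mult_left_mono[OF norm_powi_diff_le[OF z w, of n], of "norm (f n)"]
    by (simp add: deriv_seq_def norm_mult mult_ac flip: right_diff_distrib)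
  have s: "(\<lambda>n. norm (deriv_seq f n) * norm (z - w)) summable_on UNIV"
    by (rule summable_on_cmult_left[OF lp_bounded_1_D[OF Df]])
  have s': "(\<lambda>n. norm (f n * z powi n - f n * w powi n)) summable_on UNIV"
    by (rule summable_on_comparison_test[OF s]) (use le in auto)
  have "fourier f z - fourier f w = (\<Sum>\<^sub>\<infinity>n. f n * z powi n - f n * w powi n)"
    unfolding fourier_def
    using infsum_add[of "\<lambda>n. f n * z powi n" UNIV "\<lambda>n. - (f n * w powi n)"]
      fourier_summable[OF f z] fourier_summable[OF f w]
    by (simp add: infsum_uminus summable_on_uminus)
  also have "norm \<dots> \<le> (\<Sum>\<^sub>\<infinity>n. norm (f n * z powi n - f n * w powi n))"
    by (rule norm_infsum_bound[OF s'])
  also have "\<dots> \<le> (\<Sum>\<^sub>\<infinity>n. norm (deriv_seq f n) * norm (z - w))"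
    by (rule infsum_mono[OF s' s le])
  also have "\<dots> = (\<Sum>\<^sub>\<infinity>n. norm (deriv_seq f n)) * norm (z - w)"
    by (rule infsum_cmult_left')
  also have "\<dots> \<le> L * norm (z - w)"
    by (intro mult_right_mono lp_bounded_1_infsum_le Df) simp
  finally show ?thesis .
qed

lemma algebra_iso_on_inv:
  assumes T: "algebra_iso_on S T"
    and add: "\<And>f g. f \<in> S \<Longrightarrow> g \<in> S \<Longrightarrow> (\<lambda>n. f n + g n) \<in> S"
    and scale: "\<And>c f. f \<in> S \<Longrightarrow> (\<lambda>n. c * f n) \<in> S"
    and conv: "\<And>f g. f \<in> S \<Longrightarrow> g \<in> S \<Longrightarrow> conv f g \<in> S"
  shows "algebra_iso_on S (inv_into S T)"
proof -
  let ?U = "inv_into S T"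
  have bij: "bij_betw T S S" and lin: "linear_on_seq S T"
    and mult: "\<And>f g. f \<in> S \<Longrightarrow> g \<in> S \<Longrightarrow> T (Defs.conv f g) = Defs.conv (T f) (T g)"
    using T by (auto simp: algebra_iso_on_def)
  have bijU: "bij_betw ?U S S" by (rule bij_betw_inv_into[OF bij])
  have U: "?U f \<in> S" "T (?U f) = f" if "f \<in> S" for f
    using that bij bijU by (auto simp: bij_betw_inv_into_right bij_betw_apply)
  have eq: "?U f = g" if "g \<in> S" "T g = f" for f g
    using that bij by (metis bij_betw_inv_into_left)
  have "?U (\<lambda>n. f n + g n) = (\<lambda>n. ?U f n + ?U g n)" if "f \<in> S" "g \<in> S" for f g
    using that U lin by (intro eq add) (simp_all add: linear_on_seqD)
  moreover have "?U (\<lambda>n. c * f n) = (\<lambda>n. c * ?U f n)" if "f \<in> S" for f c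
    using that U lin by (intro eq scale) (simp_all add: linear_on_seqD)
  moreover have "?U (Defs.conv f g) = Defs.conv (?U f) (?U g)" if "f \<in> S" "g \<in> S" for f g
    using that U mult by (intro eq conv) simp_all
  ultimately show ?thesis using bijU by (auto simp: algebra_iso_on_def linear_on_seq_def)
qed

text \<open>With \<open>j1\<close> and \<open>pj2\<close> the exponent \<open>j - 1\<close> again
  satisfies the conditions of \<open>weighted_lp\<close>, so the space in which derivatives of
  elements of \<open>A\<close> live is a convolution algebra inside l^1 with its own Wiener
  lemma.\<close>

locale weighted_iso = weighted_lp +
  fixes T :: "(int \<Rightarrow> complex) \<Rightarrow> (int \<Rightarrow> complex)"
  assumes j1: "j \<ge> 1" and pj2: "p = 1 \<or> j \<ge> 2" and T: "algebra_iso_on A T"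
begin

sublocale low: weighted_lp p "j - 1"
  using p pj2 by unfold_locales auto

lemma bij_T: "bij_betw T A A" and lin_T: "linear_on_seq A T"
  and T_conv: "f \<in> A \<Longrightarrow> g \<in> A \<Longrightarrow> T (conv f g) = conv (T f) (T g)"
  using T by (auto simp: algebra_iso_on_def)

lemma T_A: "f \<in> A \<Longrightarrow> T f \<in> A"
  using bij_T by (auto simp: bij_betw_def)

lemmas T_add = linear_on_seqD(1)[OF lin_T]
lemmas T_scale = linear_on_seqD(2)[OF lin_T]

lemma conv_delta_0: "f \<in> A \<Longrightarrow> conv f (delta 0) = f"
  by (rule fourier_inj) (auto simp: l1_conv A_l1 l1_delta fourier_conv fourier_delta)

text \<open>Surjectivity supplies a preimage \<open>e\<close> of the unit; applying \<open>T\<close>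
  to \<open>e = conv e (delta 0)\<close> shows that the unit is also the image of
  \<open>delta 0\<close>.\<close>

lemma T_delta_0: "T (delta 0) = delta 0"
proof -
  obtain e where e: "e \<in> A" "T e = delta 0"
    using bij_T A_delta[of 0] by (metis bij_betw_iff_bijections)
  have "delta 0 = conv (T e) (T (delta 0))"
    using T_conv[OF e(1) A_delta[of 0]] conv_delta_0[OF e(1)] e(2) by simp
  also have "\<dots> = T (delta 0)"
    using conv_delta_0[OF T_A[OF A_delta[of 0]]] by (simp add: e(2) conv_commute)
  finally show ?thesis by simp
qed

definition u where "u = T (delta 1)"

lemma u_A: "u \<in> A" by (simp add: u_def T_A A_delta)

lemma fourier_T:
  assumes z: "norm z = 1"
  shows "norm (fourier u z) = 1" "f \<in> A \<Longrightarrow> fourier (T f) z = fourier f (fourier u z)"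
proof -
  have *: "norm (fourier (T (delta 1)) z) = 1 \<and> fourier (T f) z = fourier f (fourier (T (delta 1)) z)" if "f \<in> A" for f
  proof (rule character_eq_fourier[OF _ _ _ _ that])
    show "fourier (T (\<lambda>n. f n + g n)) z = fourier (T f) z + fourier (T g) z" if "f \<in> A" "g \<in> A" for f g
      using that z by (simp add: T_add fourier_add A_l1 T_A)
    show "fourier (T (\<lambda>n. c * f n)) z = c * fourier (T f) z" if "f \<in> A" for f c
      using that by (simp add: T_scale fourier_scale)
    show "fourier (T (conv f g)) z = fourier (T f) z * fourier (T g) z" if "f \<in> A" "g \<in> A" for f g
      using that z by (simp add: T_conv fourier_conv A_l1 T_A)
    show "fourier (T (delta 0)) z = 1" by (simp add: T_delta_0 fourier_delta)
  qed
  show "norm (fourier u z) = 1" unfolding u_def using *[OF A_delta] by blast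
  show "f \<in> A \<Longrightarrow> fourier (T f) z = fourier f (fourier u z)" unfolding u_def using * by blast
qed

text \<open>Composition with a circle map cannot increase the supremum, which the l^1 norm
  dominates. This is the coordinate bound required by the Baire argument.\<close>

lemma T_coord:
  assumes "f \<in> A" "lp_bounded 1 f L" shows "norm (T f n) \<le> L"
proof (rule coeff_le_sup[OF A_l1[OF T_A[OF assms(1)]]])
  fix z :: complex assume z: "norm z = 1"
  show "norm (fourier (T f) z) \<le> L"
    unfolding fourier_T(2)[OF z assms(1)] by (rule fourier_norm_le[OF assms(2) fourier_T(1)[OF z]])
qed

lemma T_bounded: "\<exists>B. \<forall>f M. weighted_bounded p j f M \<longrightarrow> weighted_bounded p j (T f) (B * M)"
  by (rule bounded_if_coordinates_bounded[OF lin_T T_A])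
     (auto intro: T_coord[OF A_I weighted_bounded_l1_bound])

section \<open>The derivative of the circle map and the chain rule\<close>

lemma deriv_seq_low: "f \<in> A \<Longrightarrow> deriv_seq f \<in> low.A"
proof -
  assume "f \<in> A"
  then obtain M where "weighted_bounded p (Suc (j - 1)) f M" using j1 by (auto simp: A_def)
  from weighted_bounded_deriv_seq[OF p this] show ?thesis by (rule low.A_I)
qed

lemma A_low: "f \<in> A \<Longrightarrow> f \<in> low.A"
  using weighted_bounded_mono[OF p _ diff_le_self order_refl] unfolding A_def low.A_def by blast

lemmas fourier_deriv = fourier_has_vector_derivative[OF A_l1 low.A_l1[OF deriv_seq_low]]

text \<open>The preimage of \<open>delta 1\<close> has a Fourier series that is Lipschitz on the
  circle and undoes the circle map, so |cis (t + h) - cis t| is at most \<open>L\<close> times the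
  increment of the map. A vanishing derivative of the map would make the derivative of
  \<open>cis\<close> vanish too.\<close>

lemma fourier_deriv_u_nonzero:
  assumes z: "norm z = 1" shows "fourier (deriv_seq u) z \<noteq> 0"
proof
  assume 0: "fourier (deriv_seq u) z = 0"
  obtain t where t: "z = cis t" using unit_circle_cis[OF z] by blast
  obtain u' where u': "u' \<in> A" "T u' = delta 1"
    using bij_T A_delta[of 1] by (metis bij_betw_iff_bijections)
  obtain L where L: "lp_bounded 1 (deriv_seq u') L"
    using abs_summable_lp_bounded_1[OF low.A_l1[OF deriv_seq_low[OF u'(1)]]] by blast
  have inv: "fourier u' (fourier u x) = x" if "norm x = 1" for x
    using fourier_T(2)[OF that u'(1)] u'(2) by (simp add: fourier_delta)
  have lim: "((\<lambda>h. (fourier u (cis (t + h)) - fourier u (cis t)) / of_real h) \<longlongrightarrow> 0) (at 0)"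
    using fourier_deriv[OF u_A u_A, of t] 0 t by (simp add: has_vector_derivative_iff_quotient)
  have "((\<lambda>h. (fourier (delta 1) (cis (t + h)) - fourier (delta 1) (cis t)) / of_real h) \<longlongrightarrow> \<i> * fourier (deriv_seq (delta 1)) (cis t)) (at 0)"
    using fourier_deriv[OF A_delta A_delta, of 1 t] by (simp add: has_vector_derivative_iff_quotient)
  moreover have "deriv_seq (delta 1) = delta 1" by (auto simp: deriv_seq_def delta_def)
  ultimately have lim1: "((\<lambda>h. (cis (t + h) - cis t) / of_real h) \<longlongrightarrow> \<i> * cis t) (at 0)"
    by (simp add: fourier_delta)
  have "norm ((cis (t + h) - cis t) / of_real h) \<le> L * norm ((fourier u (cis (t + h)) - fourier u (cis t)) / of_real h)" for h
  proof -
    have "norm (cis (t + h) - cis t) = norm (fourier u' (fourier u (cis (t + h))) - fourier u' (fourier u (cis t)))"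
      by (simp add: inv)
    also have "\<dots> \<le> L * norm (fourier u (cis (t + h)) - fourier u (cis t))"
      by (intro fourier_lipschitz A_l1 u' L fourier_T) simp_all
    finally show ?thesis by (simp add: norm_divide divide_right_mono)
  qed
  moreover have "((\<lambda>h. L * norm ((fourier u (cis (t + h)) - fourier u (cis t)) / of_real h)) \<longlongrightarrow> 0) (at 0)"
    using tendsto_mult_right_zero[OF tendsto_norm_zero[OF lim]] by simp
  ultimately have "((\<lambda>h. (cis (t + h) - cis t) / of_real h) \<longlongrightarrow> 0) (at 0)"
    by (rule Lim_null_comparison[OF always_eventually[OF allI]])
  then have "\<i> * cis t = 0" using tendsto_unique[OF _ lim1] by simp
  then show False by simp
qed

text \<open>Restricting to finite support keeps \<open>deriv_seq g\<close> in \<open>A\<close>, so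
  that \<open>T\<close> applies to it, and makes the Fourier series of \<open>g\<close> a Laurent
  polynomial with a complex derivative at every point of the circle, as the chain rule
  requires.\<close>

lemma T_deriv_ex: "\<exists>w\<in>low.A. \<forall>F g. finite F \<longrightarrow> (\<forall>n. n \<notin> F \<longrightarrow> g n = 0) \<longrightarrow>
   T (deriv_seq g) = conv w (deriv_seq (T g))"
proof -
  note Du = deriv_seq_low[OF u_A]
  obtain W where W: "W \<in> low.A" "\<And>z. norm z = 1 \<Longrightarrow> fourier (deriv_seq u) z * fourier W z = 1"
    using low.wiener_inverse fourier_deriv_u_nonzero Du unfolding low.A_def by blast
  \<comment> \<open>The multiplier is \<phi> divided by the Fourier series of
    \<open>deriv_seq u\<close>. The factor \<phi> cancels the 1 / x in the complex derivative of the
    series of \<open>g\<close>, which is the series of \<open>deriv_seq g\<close> at x divided by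
    x.\<close>
  define w where "w = conv W u"
  have w: "w \<in> low.A" unfolding w_def by (intro low.A_conv W A_low u_A)
  have "T (deriv_seq g) = conv w (deriv_seq (T g))" if F: "finite F" "\<And>n. n \<notin> F \<Longrightarrow> g n = 0" for F g
  proof -
    have gA: "g \<in> A" by (rule A_finite_support[OF F])
    have DgA: "deriv_seq g \<in> A" by (rule A_finite_support[OF F(1)]) (simp add: deriv_seq_def F(2))
    note DTg = deriv_seq_low[OF T_A[OF gA]]
    have key: "fourier (deriv_seq (T g)) z * fourier u z = fourier (deriv_seq u) z * fourier (deriv_seq g) (fourier u z)"
      if z: "norm z = 1" for z
    proof -
      obtain t where t: "z = cis t" using unit_circle_cis[OF z] by blast
      define x where "x = fourier u (cis t)"
      have x0: "x \<noteq> 0" using fourier_T(1)[OF z] t by (auto simp: x_def)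
      have "((\<lambda>y. \<Sum>k\<in>F. g k * y powi k) has_field_derivative (\<Sum>k\<in>F. g k * (of_int k * x powi (k - 1)))) (at x)"
        using x0 by (auto intro!: derivative_eq_intros simp: mult_ac)
      then have "((\<lambda>y. fourier g y) has_field_derivative (\<Sum>k\<in>F. g k * (of_int k * x powi (k - 1)))) (at x)"
        by (simp add: fourier_finite_support[OF F])
      moreover have "(\<Sum>k\<in>F. g k * (of_int k * x powi (k - 1))) = fourier (deriv_seq g) x / x"
        using x0 F by (subst fourier_finite_support[OF F(1)])
          (auto simp: deriv_seq_def power_int_diff sum_divide_distrib mult_ac)
      ultimately have dg: "((\<lambda>y. fourier g y) has_field_derivative fourier (deriv_seq g) x / x) (at x)" by simp
      have "((fourier g \<circ> (\<lambda>t. fourier u (cis t))) has_vector_derivative (\<i> * fourier (deriv_seq u) (cis t)) * (fourier (deriv_seq g) x / x)) (at t)"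
        by (rule field_vector_diff_chain_at[OF fourier_deriv[OF u_A u_A]]) (use dg in \<open>simp add: x_def\<close>)
      moreover have "fourier g \<circ> (\<lambda>t. fourier u (cis t)) = (\<lambda>t. fourier (T g) (cis t))"
        by (auto simp: fourier_T gA)
      ultimately have "(\<i> * fourier (deriv_seq u) (cis t)) * (fourier (deriv_seq g) x / x) = \<i> * fourier (deriv_seq (T g)) (cis t)"
        using vector_derivative_unique_at fourier_deriv[OF T_A T_A, OF gA gA, of t] by metis
      then show ?thesis using x0 by (simp add: t x_def[symmetric] field_simps)
    qed
    show ?thesis
    proof (rule fourier_inj)
      show "l1 (T (deriv_seq g))" by (rule A_l1[OF T_A[OF DgA]])
      show "l1 (conv w (deriv_seq (T g)))" by (intro l1_conv low.A_l1 w DTg)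
      fix z :: complex assume z: "norm z = 1"
      have "fourier (conv w (deriv_seq (T g))) z = fourier W z * (fourier (deriv_seq (T g)) z * fourier u z)"
        unfolding fourier_conv[OF low.A_l1[OF w] low.A_l1[OF DTg] z]
        unfolding w_def fourier_conv[OF low.A_l1[OF W(1)] A_l1[OF u_A] z] by (simp add: mult_ac)
      also have "\<dots> = (fourier (deriv_seq u) z * fourier W z) * fourier (deriv_seq g) (fourier u z)"
        by (simp add: key[OF z])
      also have "\<dots> = fourier (T (deriv_seq g)) z" by (simp add: W(2)[OF z] fourier_T(2)[OF z DgA])
      finally show "fourier (T (deriv_seq g)) z = fourier (conv w (deriv_seq (T g))) z" by simp
    qed
  qed
  then show ?thesis using w by blast
qed

text \<open>If p = 1 or i < j - 1, the remaining j - 1 - i powers of the weight on \<open>w\<close>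
  place it in l^1 with weight exponent i, where it is a multiplier. In the remaining case i = j - 1
  and the space is an algebra containing \<open>w\<close>.\<close>

lemma low_multiplier:
  assumes w: "w \<in> low.A" and i: "i \<le> j - 1"
  shows "\<exists>B. \<forall>h M. weighted_bounded p i h M \<longrightarrow> weighted_bounded p i (conv w h) (B * M)"
proof -
  obtain N where N: "weighted_bounded p (j - 1) w N" using w unfolding low.A_def by blast
  show ?thesis
  proof (cases "p = 1 \<or> i < j - 1")
    case True
    interpret q: weighted_lp p "j - 1 - i" using True p i by unfold_locales auto
    have "wt (j - 1) n = wt i n * wt (j - 1 - i) n" for n
      unfolding wt_def power_add[symmetric] le_add_diff_inverse[OF i] by (rule refl)
    then have "weighted_bounded p (j - 1 - i) (\<lambda>n. w n * of_real (wt i n)) N"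
      using N by (simp add: weighted_bounded_def mult.assoc)
    from weighted_bounded_conv_multiplier[OF p q.weighted_bounded_l1_bound[OF this]]
    show ?thesis by (metis mult.assoc)
  next
    case False
    then have "i = j - 1" using i by simp
    then show ?thesis using low.weighted_bounded_conv[OF N] by blast
  qed
qed

text \<open>Only the target exponent descends: the hypothesis always concerns the norm of
  \<open>g\<close> with weight exponent \<open>j\<close>. In each step \<open>deriv_seq\<close>
  lowers the exponent by one and convolution with \<open>w\<close> preserves the new one.\<close>

lemma T_bound_step:
  "i \<le> j \<Longrightarrow> \<exists>B. \<forall>F g M. finite F \<longrightarrow> (\<forall>n. n \<notin> F \<longrightarrow> g n = 0) \<longrightarrow> weighted_bounded p j g M \<longrightarrow>
     weighted_bounded p (j - i) (T ((deriv_seq ^^ i) g)) (B * M)"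
proof (induction i)
  case 0
  then show ?case using T_bounded by auto
next
  case (Suc i)
  from Suc.prems have "i \<le> j" by simp
  from Suc.IH[OF this] obtain B where B: "\<And>F g M. finite F \<Longrightarrow> (\<And>n. n \<notin> F \<Longrightarrow> g n = 0) \<Longrightarrow> weighted_bounded p j g M \<Longrightarrow>
     weighted_bounded p (j - i) (T ((deriv_seq ^^ i) g)) (B * M)" by blast
  obtain w where w: "w \<in> low.A" "\<And>F g. finite F \<Longrightarrow> (\<And>n. n \<notin> F \<Longrightarrow> g n = 0) \<Longrightarrow>
      T (deriv_seq g) = conv w (deriv_seq (T g))"
    using T_deriv_ex by blast
  obtain B' where B': "\<And>h M. weighted_bounded p (j - Suc i) h M \<Longrightarrow> weighted_bounded p (j - Suc i) (conv w h) (B' * M)"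
    using low_multiplier[OF w(1) diff_le_mono2[of 1 "Suc i" j]] by auto
  have "weighted_bounded p (j - Suc i) (T ((deriv_seq ^^ Suc i) g)) (B' * B * M)"
    if F: "finite F" "\<And>n. n \<notin> F \<Longrightarrow> g n = 0" and g: "weighted_bounded p j g M" for F g M
  proof -
    have supp: "(deriv_seq ^^ i) g n = 0" if "n \<notin> F" for n
      by (induction i) (simp_all add: F(2)[OF that] deriv_seq_def)
    \<comment> \<open>As Suc i \<le> j, this exponent equals j - i; written as a successor it
      matches the lemma on \<open>deriv_seq\<close>.\<close>
    have "weighted_bounded p (Suc (j - Suc i)) (T ((deriv_seq ^^ i) g)) (B * M)"
      using B[OF F g] Suc.prems by (simp add: Suc_diff_Suc)
    from B'[OF weighted_bounded_deriv_seq[OF p this]] show ?thesis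
      by (simp add: w(2)[OF F(1) supp] mult.assoc)
  qed
  then show ?case by blast
qed

text \<open>The coefficient at 0, which \<open>deriv_seq\<close> annihilates, is carried separately:
  \<open>T\<close> fixes \<open>delta 0\<close>, and |f 0| \<le> M accounts for the 1 in the
  constant 1 + |B|.\<close>

theorem T_lp_bounded_finite_support:
  "\<exists>B\<ge>0. \<forall>F f M. finite F \<longrightarrow> (\<forall>n. n \<notin> F \<longrightarrow> f n = 0) \<longrightarrow> lp_bounded p f M \<longrightarrow> lp_bounded p (T f) (B * M)"
proof -
  obtain B where B: "\<And>F g M. finite F \<Longrightarrow> (\<And>n. n \<notin> F \<Longrightarrow> g n = 0) \<Longrightarrow> weighted_bounded p j g M \<Longrightarrow>
     weighted_bounded p 0 (T ((deriv_seq ^^ j) g)) (B * M)" 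
    using T_bound_step[OF order_refl] unfolding diff_self_eq_0 by blast
  have "lp_bounded p (T f) ((1 + \<bar>B\<bar>) * M)"
    if F: "finite F" "\<And>n. n \<notin> F \<Longrightarrow> f n = 0" and f: "lp_bounded p f M" for F f M
  proof -
    define g where "g n = (if n = 0 then 0 else f n / of_int n ^ j)" for n
    define f' where "f' = (deriv_seq ^^ j) g"
    have D: "(deriv_seq ^^ i) g n = of_int n ^ i * g n" for i n
      by (induction i) (simp_all add: deriv_seq_def)
    have f'_eq: "f' n = (if n = 0 then 0 else f n)" for n
      unfolding f'_def D using j1 by (simp add: g_def)
    have "norm (g n * of_real (wt j n)) \<le> norm (f n)" for n
    proof (cases "n = 0")
      case False
      then have "wt j n = \<bar>of_int n\<bar> ^ j" by (simp add: wt_def max_def)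
      then show ?thesis unfolding norm_times_wt using False by (simp add: g_def norm_divide norm_power)
    qed (simp add: g_def)
    then have g: "weighted_bounded p j g M" unfolding weighted_bounded_def by (intro lp_bounded_mono[OF p f]) auto
    have "lp_bounded p (T f') (B * M)"
      using B[OF F(1) _ g] F(2) by (simp add: weighted_bounded_0 f'_def g_def)
    then have f': "lp_bounded p (T f') (\<bar>B\<bar> * M)"
      by (rule lp_bounded_mono[OF p]) (auto intro: mult_right_mono lp_bounded_nonneg[OF f])
    have f'A: "f' \<in> A" by (rule A_finite_support[OF F(1)]) (simp add: f'_eq F(2))
    have "f = (\<lambda>n. f 0 * delta 0 n + f' n)" by (auto simp: f'_eq delta_def)
    then have Tf: "T f = (\<lambda>n. f 0 * delta 0 n + T f' n)"
      using T_add[OF A_scale[OF A_delta[of 0], of "f 0"] f'A] T_scale[OF A_delta[of 0], of "f 0"]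
      by (simp add: T_delta_0)
    have "lp_bounded p (T f) (norm (f 0) * 1 + \<bar>B\<bar> * M)"
      unfolding Tf by (intro lp_bounded_add lp_bounded_scale lp_bounded_delta p f')
    then show ?thesis
      by (rule lp_bounded_mono[OF p]) (use lp_bounded_coord[OF p f, of 0] in \<open>auto simp: algebra_simps\<close>)
  qed
  then show ?thesis by (intro exI[of _ "1 + \<bar>B\<bar>"]) auto
qed

section \<open>The extension to l^p\<close>

definition S :: "(int \<Rightarrow> complex) \<Rightarrow> int \<Rightarrow> complex" where
  "S f n = (\<Sum>\<^sub>\<infinity>k. f k * T (delta k) n)"

lemma T_trunc:
  assumes "finite F" shows "T (trunc F f) = (\<lambda>n. \<Sum>k\<in>F. f k * T (delta k) n)"
proof -
  have "(\<lambda>n. \<Sum>k\<in>F. f k * delta k n) \<in> A \<and> T (\<lambda>n. \<Sum>k\<in>F. f k * delta k n) = (\<lambda>n. \<Sum>k\<in>F. f k * T (delta k) n)"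
    using assms
  proof (induction F)
    case empty
    have "(\<lambda>n. 0) \<in> A" using A_scale[OF A_delta, of 0] by simp
    then show ?case using T_scale[of "\<lambda>n. 0" 0] by simp
  next
    case (insert k F)
    have "(\<lambda>n. f k * delta k n) \<in> A" by (intro A_scale A_delta)
    then show ?case using insert T_scale[OF A_delta[of k], of "f k"] by (simp add: T_add A_add)
  qed
  then show ?thesis by (simp add: trunc_eq_sum[OF assms])
qed

text \<open>\<open>S\<close> lets the matrix of \<open>T\<close> act coordinate by coordinate. Each
  row of the matrix is a functional bounded on finitely supported sequences in l^p norm, which gives
  absolute convergence against every sequence of l^p.\<close>

lemma S_summable:
  assumes "lp_bounded p f M" shows "(\<lambda>k. f k * T (delta k) n) summable_on UNIV"
proof -
  obtain B where B: "\<And>F f M. finite F \<Longrightarrow> (\<And>n. n \<notin> F \<Longrightarrow> f n = 0) \<Longrightarrow> lp_bounded p f M \<Longrightarrow> lp_bounded p (T f) (B * M)"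
    using T_lp_bounded_finite_support by blast
  have "(\<Sum>k\<in>F. norm (f k * T (delta k) n)) \<le> B * M" if F: "finite F" for F
  proof -
    \<comment> \<open>Rotating each coefficient makes all summands nonnegative without changing the norm.\<close>
    define f' where "f' k = of_real (norm (f k)) * cnj (sgn (T (delta k) n))" for k
    have "lp_bounded p (trunc F f') M"
      by (rule lp_bounded_mono[OF p assms]) (auto simp: trunc_def f'_def norm_mult norm_sgn)
    then have "lp_bounded p (T (trunc F f')) (B * M)"
      by (rule B[OF F, rotated]) (simp add: trunc_def)
    then have "norm (\<Sum>k\<in>F. f' k * T (delta k) n) \<le> B * M"
      using lp_bounded_coord[OF p, of "T (trunc F f')" _ n] by (simp add: T_trunc[OF F])
    moreover have "f' k * T (delta k) n = of_real (norm (f k * T (delta k) n))" for k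
    proof -
      have "cnj (sgn x) * x = of_real (norm x)" for x :: complex
        by (cases "x = 0") (simp_all add: sgn_eq complex_norm_square[symmetric] mult.commute[of _ x] power2_eq_square)
      then show ?thesis by (simp add: f'_def norm_mult mult.assoc)
    qed
    ultimately have "norm (complex_of_real (\<Sum>k\<in>F. norm (f k * T (delta k) n))) \<le> B * M" by simp
    then show ?thesis unfolding norm_of_real by simp
  qed
  then have "(\<lambda>k. norm (f k * T (delta k) n)) summable_on UNIV"
    unfolding Infinite_Sum.abs_summable_iff_bdd_above by (auto intro!: bdd_aboveI2)
  then show ?thesis by (rule abs_summable_summable)
qed

lemma S_bounded: "\<exists>B\<ge>0. \<forall>f M. lp_bounded p f M \<longrightarrow> lp_bounded p (S f) (B * M)"
proof -
  obtain B where B0: "B \<ge> 0" and B: "\<And>F f M. finite F \<Longrightarrow> (\<And>n. n \<notin> F \<Longrightarrow> f n = 0) \<Longrightarrow> lp_bounded p f M \<Longrightarrow> lp_bounded p (T f) (B * M)"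
    using T_lp_bounded_finite_support by blast
  have "lp_bounded p (S f) (B * M)" if f: "lp_bounded p f M" for f M
  proof (rule lp_bounded_tendsto[OF p])
    show "((\<lambda>F. \<Sum>k\<in>F. f k * T (delta k) n) \<longlongrightarrow> S f n) (finite_subsets_at_top UNIV)" for n
      unfolding S_def by (rule infsum_tendsto[OF S_summable[OF f]])
    show "\<forall>\<^sub>F F in finite_subsets_at_top UNIV. lp_bounded p (\<lambda>n. \<Sum>k\<in>F. f k * T (delta k) n) (B * M)"
    proof (rule eventually_finite_subsets_at_top_weakI)
      fix F :: "int set" assume F: "finite F"
      have "lp_bounded p (trunc F f) M"
        by (rule lp_bounded_mono[OF p f]) (auto simp: trunc_def)
      from B[OF F _ this] show "lp_bounded p (\<lambda>n. \<Sum>k\<in>F. f k * T (delta k) n) (B * M)"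
        by (simp add: trunc_def T_trunc[OF F, symmetric])
    qed
  qed auto
  then show ?thesis using B0 by blast
qed

lemma S_linear: "linear_on_seq (lp_space p) S"
proof -
  have "S (\<lambda>n. f n + g n) n = S f n + S g n" if fg: "f \<in> lp_space p" "g \<in> lp_space p" for f g n
  proof -
    obtain M N where "lp_bounded p f M" "lp_bounded p g N"
      using fg by (auto simp: lp_space_iff_bounded[OF p])
    then show ?thesis unfolding S_def distrib_right by (intro infsum_add S_summable)
  qed
  moreover have "S (\<lambda>n. c * f n) n = c * S f n" for c f n
    unfolding S_def mult.assoc by (rule infsum_cmult_right')
  ultimately show ?thesis unfolding linear_on_seq_def by blast
qed

text \<open>A coordinate of \<open>T\<close> on the remainder f - \<open>trunc F f\<close> is
  bounded by the l^1 norm of that remainder, which tends to 0 along the finite sets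
  \<open>F\<close>.\<close>

lemma S_eq_T: "f \<in> A \<Longrightarrow> S f = T f"
proof
  fix n assume f: "f \<in> A"
  obtain M where M: "weighted_bounded p j f M" using f by (auto simp: A_def)
  have fs: "((\<lambda>F. \<Sum>k\<in>F. f k * T (delta k) n) \<longlongrightarrow> S f n) (finite_subsets_at_top UNIV)"
    unfolding S_def by (rule infsum_tendsto[OF S_summable[OF weighted_bounded_lp_bounded[OF p M]]])
  have "((\<lambda>F. T f n - (\<Sum>k\<in>F. f k * T (delta k) n)) \<longlongrightarrow> 0) (finite_subsets_at_top UNIV)"
  proof (rule Lim_null_comparison)
    define L where "L = (\<Sum>\<^sub>\<infinity>k. norm (f k))"
    have lf: "l1 f" by (rule A_l1[OF f])
    show "\<forall>\<^sub>F F in finite_subsets_at_top UNIV.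
       norm (T f n - (\<Sum>k\<in>F. f k * T (delta k) n)) \<le> L - (\<Sum>k\<in>F. norm (f k))"
    proof (rule eventually_finite_subsets_at_top_weakI)
      fix F :: "int set" assume F: "finite F"
      have tA: "trunc F f \<in> A" by (rule A_finite_support[OF F]) (simp add: trunc_def)
      have "lp_bounded 1 (\<lambda>k. f k - trunc F f k) (L - (\<Sum>k\<in>F. norm (f k)))"
        unfolding lp_bounded_1_iff
      proof (intro conjI allI impI)
        show "0 \<le> L - (\<Sum>k\<in>F. norm (f k))"
          unfolding L_def using F lf by (simp add: finite_sum_le_infsum)
        fix X :: "int set" assume X: "finite X"
        have "(\<Sum>k\<in>X. norm (f k - trunc F f k)) = (\<Sum>k\<in>X - F. norm (f k))"
          using X by (intro sum.mono_neutral_cong_right) (auto simp: trunc_def)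
        also have "\<dots> = (\<Sum>k\<in>(X - F) \<union> F. norm (f k)) - (\<Sum>k\<in>F. norm (f k))"
          using X F by (subst sum.union_disjoint) auto
        also have "\<dots> \<le> L - (\<Sum>k\<in>F. norm (f k))"
          unfolding L_def using X F lf by (intro diff_right_mono finite_sum_le_infsum) auto
        finally show "(\<Sum>k\<in>X. norm (f k - trunc F f k)) \<le> L - (\<Sum>k\<in>F. norm (f k))" .
      qed
      from T_coord[OF A_diff[OF f tA] this, of n]
      show "norm (T f n - (\<Sum>k\<in>F. f k * T (delta k) n)) \<le> L - (\<Sum>k\<in>F. norm (f k))"
        by (simp add: linear_on_seq_diff[OF lin_T f tA] T_trunc[OF F])
    qed
    have "((\<lambda>F. L - (\<Sum>k\<in>F. norm (f k))) \<longlongrightarrow> L - L) (finite_subsets_at_top UNIV)"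
      unfolding L_def by (intro tendsto_diff tendsto_const infsum_tendsto lf)
    then show "((\<lambda>F. L - (\<Sum>k\<in>F. norm (f k))) \<longlongrightarrow> 0) (finite_subsets_at_top UNIV)" by simp
  qed
  from tendsto_diff[OF tendsto_const[of "T f n"] this]
  have "((\<lambda>F. \<Sum>k\<in>F. f k * T (delta k) n) \<longlongrightarrow> T f n) (finite_subsets_at_top UNIV)" by simp
  from tendsto_unique[OF _ fs this] show "S f n = T f n" by simp
qed

end

text \<open>On a finitely supported g the composite is V (T g) = g, because \<open>S\<close> and
  \<open>T\<close> agree on \<open>A\<close>, which contains both g and T g. Density and boundedness
  carry the identity over to l^p. It is used in both directions, with \<open>T\<close> and
  \<open>V\<close> exchanged.\<close>

lemma (in weighted_iso) S_left_inverse: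
  assumes V: "weighted_iso p j V" and VT: "\<And>f. f \<in> A \<Longrightarrow> V (T f) = f" and f: "f \<in> lp_space p"
  shows "weighted_iso.S V (S f) = f"
proof
  fix n
  interpret V: weighted_iso p j V by (rule V)
  obtain B B' where B: "B \<ge> 0" "\<And>f M. lp_bounded p f M \<Longrightarrow> lp_bounded p (S f) (B * M)"
    and B': "B' \<ge> 0" "\<And>f M. lp_bounded p f M \<Longrightarrow> lp_bounded p (V.S f) (B' * M)"
    using S_bounded V.S_bounded by blast
  obtain M where M: "lp_bounded p f M" using f by (auto simp: lp_space_iff_bounded[OF p])
  have diff: "Q (\<lambda>n. f n - g n) = (\<lambda>n. Q f n - Q g n)"
    if "linear_on_seq (lp_space p) Q" "f \<in> lp_space p" "g \<in> lp_space p" for Q f g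
  proof -
    have "(\<lambda>n. (- 1) * g n) \<in> lp_space p"
      using that(3) lp_bounded_scale[OF p] unfolding lp_space_iff_bounded[OF p] by blast
    from linear_on_seqD(1)[OF that(1,2) this] linear_on_seqD(2)[OF that(1,3), of "- 1"]
    show ?thesis by simp
  qed
  have "norm (V.S (S f) n - f n) \<le> 0 + e" if e: "e > 0" for e
  proof -
    \<comment> \<open>The remainder f - g contributes at most B' B d through the two extensions and
      at most d directly, hence e in total.\<close>
    define d where "d = e / (B' * B + 1)"
    have BB: "B' * B + 1 > 0" using B(1) B'(1) by (simp add: add_nonneg_pos)
    have d: "d > 0" using BB e by (simp add: d_def)
    obtain F where F: "finite F" "lp_bounded p (\<lambda>n. f n - trunc F f n) d"
      using lp_bounded_trunc_small[OF p M d] by blast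
    define g where "g = trunc F f"
    have gA: "g \<in> A" unfolding g_def by (rule A_finite_support[OF F(1)]) (simp add: trunc_def)
    have g: "g \<in> lp_space p"
      using gA weighted_bounded_lp_bounded[OF p] unfolding A_def lp_space_iff_bounded[OF p] by blast
    have Slp: "S h \<in> lp_space p" if "h \<in> lp_space p" for h
      using that B(2) unfolding lp_space_iff_bounded[OF p] by blast
    have "V.S (S g) = g" using S_eq_T[OF gA] V.S_eq_T[OF T_A[OF gA]] VT[OF gA] by simp
    moreover have "V.S (S (\<lambda>n. f n - g n)) = (\<lambda>n. V.S (S f) n - V.S (S g) n)"
      using diff[OF S_linear f g] diff[OF V.S_linear Slp[OF f] Slp[OF g]] by simp
    moreover have "norm (V.S (S (\<lambda>n. f n - g n)) n) \<le> B' * (B * d)"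
      using lp_bounded_coord[OF p B'(2)[OF B(2)[OF F(2)]]] by (simp add: g_def)
    moreover have "norm (f n - g n) \<le> d"
      using lp_bounded_coord[OF p F(2)] by (simp add: g_def)
    ultimately have "norm (V.S (S f) n - f n) \<le> B' * (B * d) + d"
      using norm_triangle_ineq4[of "V.S (S f) n - g n" "f n - g n"] by simp
    also have "\<dots> = (B' * B + 1) * d" by (simp add: algebra_simps)
    also have "\<dots> = e" using BB by (simp add: d_def)
    finally show ?thesis by simp
  qed
  then have "norm (V.S (S f) n - f n) \<le> 0" by (rule field_le_epsilon)
  then show "V.S (S f) n = f n" by simp
qed

theorem theorem3p1:
  fixes a :: int and p :: real
    and T :: "(int \<Rightarrow> complex) \<Rightarrow> (int \<Rightarrow> complex)"
  assumes "p \<ge> 1"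
    and "(a \<ge> 1 \<and> p = 1) \<or> (a \<ge> 2 \<and> p > 1)"
    and "algebra_iso_on (lp_weighted p a) T"
  shows "\<exists>S. (\<forall>f\<in>lp_weighted p a. S f = T f) \<and>
             linear_on_seq (lp_space p) S \<and>
             (\<exists>C. \<forall>f\<in>lp_space p. lp_norm p (S f) \<le> C * lp_norm p f) \<and>
             bij_betw S (lp_space p) (lp_space p)"
proof -
  interpret weighted_lp p "nat a" using assms by unfold_locales auto
  have A: "lp_weighted p a = A" using lp_weighted_iff[OF assms(1)] by (auto simp: A_def)
  define V where "V = inv_into A T"
  have isoT: "algebra_iso_on A T" using assms(3) by (simp add: A)
  have isoV: "algebra_iso_on A V"
    unfolding V_def by (intro algebra_iso_on_inv isoT A_add A_scale A_conv)
  \<comment> \<open>The hypotheses are symmetric in \<open>T\<close> and its inverse, so both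
    receive extensions, and these turn out to be inverse to each other on l^p.\<close>
  interpret T: weighted_iso p "nat a" T using assms(2) isoT by unfold_locales auto
  interpret V: weighted_iso p "nat a" V using assms(2) isoV by unfold_locales auto
  have VT: "V (T f) = f" and TV: "T (V f) = f" if "f \<in> A" for f
    using that T.bij_T by (simp_all add: V_def bij_betw_inv_into_left bij_betw_inv_into_right)
  obtain B where B: "B \<ge> 0" "\<And>f M. lp_bounded p f M \<Longrightarrow> lp_bounded p (T.S f) (B * M)"
    using T.S_bounded by blast
  have maps: "T.S f \<in> lp_space p" "V.S f \<in> lp_space p" if "f \<in> lp_space p" for f
    using that T.S_bounded V.S_bounded unfolding lp_space_iff_bounded[OF p] by blast+
  have "bij_betw T.S (lp_space p) (lp_space p)"
  proof (rule bij_betwI[of _ _ _ V.S])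
    show "V.S (T.S f) = f" if "f \<in> lp_space p" for f
      by (rule T.S_left_inverse[OF V.weighted_iso_axioms VT that])
    show "T.S (V.S f) = f" if "f \<in> lp_space p" for f
      by (rule V.S_left_inverse[OF T.weighted_iso_axioms TV that])
  qed (use maps in auto)
  moreover have "lp_norm p (T.S f) \<le> B * lp_norm p f" if "f \<in> lp_space p" for f
    using that by (intro lp_norm_le[OF p] B(2) lp_bounded_lp_norm[OF p])
  ultimately show ?thesis
    using T.S_eq_T T.S_linear unfolding A by blast
qed

end
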